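(* Let $\phi : X\to Y$ be a continuous map of topological spaces and let $\mathcal{G}$ be a sheaf of abelian groups on $X$. Let $i : X\to\mathrm{Filt}\,X$ be the canonical map $x\mapsto U(x)$ and let $\psi : Y\to\mathrm{Filt}\,X$ be the map sending $y$ to the filter generated by $\{\phi^{-1}(V): V\subseteq Y\text{ open}, y\in V\}$. Then for every $n$ the higher direct image sheaf $R^n\phi_\ast(\mathcal{G})$ on $Y$ is equal (canonically isomorphic) to the inverse image under $\psi$ of the higher direct image sheaf on the filtrum: $$R^n\phi_\ast(\mathcal{G})=\psi^{-1}\bigl(R^n i_\ast(\mathcal{G})\bigr).$$ In particular, if $R^n i_\ast(\mathcal{G})=0$, then $R^n\phi_\ast(\mathcal{G})=0$.
   Context: A topological filter on a topological space $X$ is a set $F$ of open subsets of $X$ with $X\in F$, closed under finite intersections, and containing with each $U\in F$ every open set $U'\supseteq U$ (the set of all open subsets is allowed). $\mathrm{Filt}\,X$ is the set of all topological filters on $X$ with the topology having as basis the sets $D(U)=\{F:U\in F\}$, $U\subseteq X$ open. $U(x)$ is the filter of open neighborhoods of $x$. The filter generated by a set of open sets is the smallest topological filter containing it. The maps $i$ and $\psi$ are continuous. $R^n\phi_\ast$ is the $n$-th right derived functor of the direct image functor on sheaves of abelian groups. *)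

theory Defs
  imports "HOL-Algebra.Coset" "HOL-Analysis.Abstract_Topology"
begin

section \<open>Topological filters and the filtrum\<close>

definition topological_filter :: "'x topology \<Rightarrow> 'x set set \<Rightarrow> bool" where
  "topological_filter X F \<longleftrightarrow>
     F \<subseteq> {U. openin X U} \<and> topspace X \<in> F \<and>
     (\<forall>U\<in>F. \<forall>V\<in>F. U \<inter> V \<in> F) \<and>
     (\<forall>U\<in>F. \<forall>U'. openin X U' \<and> U \<subseteq> U' \<longrightarrow> U' \<in> F)"

definition filt_basic :: "'x topology \<Rightarrow> 'x set \<Rightarrow> 'x set set set" where
  "filt_basic X U = {F. topological_filter X F \<and> U \<in> F}"

text \<open>The open sets are the unions of basic sets; see \<open>openin_filt\<close> below.\<close>

definition filt :: "'x topology \<Rightarrow> 'x set set topology" where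
  "filt X = topology (arbitrary union_of (\<lambda>B. \<exists>U. openin X U \<and> B = filt_basic X U))"

definition nbhd_filter :: "'x topology \<Rightarrow> 'x \<Rightarrow> 'x set set" where
  "nbhd_filter X x = {U. openin X U \<and> x \<in> U}"

definition generated_filter :: "'x topology \<Rightarrow> 'x set set \<Rightarrow> 'x set set" where
  "generated_filter X S = \<Inter>{F. topological_filter X F \<and> S \<subseteq> F}"

definition preimage :: "'x topology \<Rightarrow> ('x \<Rightarrow> 'y) \<Rightarrow> 'y set \<Rightarrow> 'x set" where
  "preimage X f V = {x \<in> topspace X. f x \<in> V}"

definition psi :: "'x topology \<Rightarrow> 'y topology \<Rightarrow> ('x \<Rightarrow> 'y) \<Rightarrow> 'y \<Rightarrow> 'x set set" where
  "psi X Y \<phi> y = generated_filter X {preimage X \<phi> V |V. openin Y V \<and> y \<in> V}"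

lemma filt_basic_Int:
  assumes "openin X U" "openin X V"
  shows "filt_basic X U \<inter> filt_basic X V = filt_basic X (U \<inter> V)"
proof (intro subset_antisym subsetI)
  fix F assume "F \<in> filt_basic X U \<inter> filt_basic X V"
  then show "F \<in> filt_basic X (U \<inter> V)"
    by (simp add: filt_basic_def topological_filter_def)
next
  fix F assume "F \<in> filt_basic X (U \<inter> V)"
  then have F: "topological_filter X F" and "U \<inter> V \<in> F"
    by (simp_all add: filt_basic_def)
  then have "U \<in> F" "V \<in> F"
    using assms unfolding topological_filter_def by (meson inf_le1 inf_le2)+
  with F show "F \<in> filt_basic X U \<inter> filt_basic X V"
    by (simp add: filt_basic_def)
qed

lemma openin_filt:
  "openin (filt X) = (arbitrary union_of (\<lambda>B. \<exists>U. openin X U \<and> B = filt_basic X U))"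
proof -
  have "istopology (arbitrary union_of (\<lambda>B. \<exists>U. openin X U \<and> B = filt_basic X U))"
    by (rule istopology_base) (metis filt_basic_Int openin_Int)
  then show ?thesis by (simp add: filt_def)
qed

lemma topspace_filt: "topspace (filt X) = {F. topological_filter X F}"
proof
  show "topspace (filt X) \<subseteq> {F. topological_filter X F}"
    using openin_topspace[of "filt X"]
    unfolding openin_filt union_of_def filt_basic_def by fastforce
  have "openin (filt X) (filt_basic X (topspace X))"
    unfolding openin_filt by (rule union_of_inc) (auto simp: arbitrary_def)
  moreover have "filt_basic X (topspace X) = {F. topological_filter X F}"
    by (auto simp: filt_basic_def topological_filter_def)
  ultimately show "{F. topological_filter X F} \<subseteq> topspace (filt X)"
    by (metis openin_subset)
qed


section \<open>Sheaves of abelian groups\<close>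

text \<open>
  Abelian groups are commutative groups in the sense of HOL-Algebra, written multiplicatively;
  the trivial subgroup is \<open>{\<one>}\<close>. Values of a presheaf at sets that are not open, and restrictions
  along anything but an inclusion of open sets, carry no meaning.
\<close>

record ('x, 'u) presheaf =
  sections :: "'x set \<Rightarrow> 'u monoid"
  restr :: "'x set \<Rightarrow> 'x set \<Rightarrow> 'u \<Rightarrow> 'u"

definition is_presheaf :: "'x topology \<Rightarrow> ('x, 'u) presheaf \<Rightarrow> bool" where
  "is_presheaf X F \<longleftrightarrow>
     (\<forall>U. openin X U \<longrightarrow> comm_group (sections F U)) \<and>
     (\<forall>U V. openin X U \<and> openin X V \<and> V \<subseteq> U \<longrightarrow>
        restr F U V \<in> hom (sections F U) (sections F V)) \<and>
     (\<forall>U. openin X U \<longrightarrow> (\<forall>s \<in> carrier (sections F U). restr F U U s = s)) \<and>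
     (\<forall>U V W. openin X U \<and> openin X V \<and> openin X W \<and> W \<subseteq> V \<and> V \<subseteq> U \<longrightarrow>
        (\<forall>s \<in> carrier (sections F U). restr F V W (restr F U V s) = restr F U W s))"

text \<open>
  The members of a cover index the local sections. This loses nothing: in a compatible family
  indexed by an arbitrary set, equal members of the cover carry equal sections.
\<close>

definition sheaf :: "'x topology \<Rightarrow> ('x, 'u) presheaf \<Rightarrow> bool" where
  "sheaf X F \<longleftrightarrow>
     is_presheaf X F \<and>
     (\<forall>\<U> s. (\<forall>U\<in>\<U>. openin X U) \<and>
            (\<forall>U\<in>\<U>. s U \<in> carrier (sections F U)) \<and>
            (\<forall>U\<in>\<U>. \<forall>V\<in>\<U>. restr F U (U \<inter> V) (s U) = restr F V (U \<inter> V) (s V)) \<longrightarrow>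
        (\<exists>!t. t \<in> carrier (sections F (\<Union>\<U>)) \<and> (\<forall>U\<in>\<U>. restr F (\<Union>\<U>) U t = s U)))"

definition sheaf_hom ::
  "'x topology \<Rightarrow> ('x, 'u) presheaf \<Rightarrow> ('x, 'w) presheaf \<Rightarrow> ('x set \<Rightarrow> 'u \<Rightarrow> 'w) \<Rightarrow> bool" where
  "sheaf_hom X F G \<eta> \<longleftrightarrow>
     (\<forall>U. openin X U \<longrightarrow> \<eta> U \<in> hom (sections F U) (sections G U)) \<and>
     (\<forall>U V. openin X U \<and> openin X V \<and> V \<subseteq> U \<longrightarrow>
        (\<forall>s \<in> carrier (sections F U). \<eta> V (restr F U V s) = restr G U V (\<eta> U s)))"

definition sheaf_mono ::
  "'x topology \<Rightarrow> ('x, 'u) presheaf \<Rightarrow> ('x, 'w) presheaf \<Rightarrow> ('x set \<Rightarrow> 'u \<Rightarrow> 'w) \<Rightarrow> bool" where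
  "sheaf_mono X F G \<eta> \<longleftrightarrow>
     sheaf_hom X F G \<eta> \<and> (\<forall>U. openin X U \<longrightarrow> inj_on (\<eta> U) (carrier (sections F U)))"

definition sheaf_iso ::
  "'x topology \<Rightarrow> ('x, 'u) presheaf \<Rightarrow> ('x, 'w) presheaf \<Rightarrow> ('x set \<Rightarrow> 'u \<Rightarrow> 'w) \<Rightarrow> bool" where
  "sheaf_iso X F G \<eta> \<longleftrightarrow>
     sheaf_hom X F G \<eta> \<and> (\<forall>U. openin X U \<longrightarrow> \<eta> U \<in> iso (sections F U) (sections G U))"

definition zero_sheaf :: "'x topology \<Rightarrow> ('x, 'u) presheaf \<Rightarrow> bool" where
  "zero_sheaf X F \<longleftrightarrow> (\<forall>U. openin X U \<longrightarrow> carrier (sections F U) = {\<one>\<^bsub>sections F U\<^esub>})"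


section \<open>Direct limits, stalks and sheafification\<close>

text \<open>
  \<open>colim F N\<close> is the direct limit of the groups of sections over a family \<open>N\<close> of open sets that is
  closed under finite intersections; its elements are the equivalence classes of pairs of a
  member of \<open>N\<close> and a section over it. Operations on classes are unions over all representatives,
  and all these representatives give the same class.
\<close>

definition germ ::
  "('x, 'u) presheaf \<Rightarrow> 'x set set \<Rightarrow> 'x set \<Rightarrow> 'u \<Rightarrow> ('x set \<times> 'u) set" where
  "germ F N U s =
     {(V, t). V \<in> N \<and> t \<in> carrier (sections F V) \<and>
              (\<exists>W\<in>N. W \<subseteq> U \<inter> V \<and> restr F U W s = restr F V W t)}"

definition colim :: "('x, 'u) presheaf \<Rightarrow> 'x set set \<Rightarrow> ('x set \<times> 'u) set monoid" where
  "colim F N =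
     \<lparr>carrier = {germ F N U s |U s. U \<in> N \<and> s \<in> carrier (sections F U)},
      monoid.mult = (\<lambda>a b. \<Union>(U, s)\<in>a. \<Union>(V, t)\<in>b.
        germ F N (U \<inter> V)
          (restr F U (U \<inter> V) s \<otimes>\<^bsub>sections F (U \<inter> V)\<^esub> restr F V (U \<inter> V) t)),
      one = (\<Union>U\<in>N. germ F N U \<one>\<^bsub>sections F U\<^esub>)\<rparr>"

abbreviation stalk :: "'x topology \<Rightarrow> ('x, 'u) presheaf \<Rightarrow> 'x \<Rightarrow> ('x set \<times> 'u) set monoid" where
  "stalk X F x \<equiv> colim F (nbhd_filter X x)"

definition germs ::
  "'x topology \<Rightarrow> ('x, 'u) presheaf \<Rightarrow> 'x set \<Rightarrow> 'u \<Rightarrow> 'x \<Rightarrow> ('x set \<times> 'u) set" where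
  "germs X F U s = (\<lambda>x\<in>U. germ F (nbhd_filter X x) U s)"

text \<open>
  The associated sheaf: sections over \<open>U\<close> are the families of germs that locally come from sections
  of the presheaf. The canonical morphism from the presheaf to it is \<open>germs X F\<close>.
\<close>

definition sheafify ::
  "'x topology \<Rightarrow> ('x, 'u) presheaf \<Rightarrow> ('x, 'x \<Rightarrow> ('x set \<times> 'u) set) presheaf" where
  "sheafify X F =
     \<lparr>sections = (\<lambda>U.
        \<lparr>carrier = {\<sigma> \<in> (\<Pi>\<^sub>E x\<in>U. carrier (stalk X F x)).
           \<forall>x\<in>U. \<exists>V s. openin X V \<and> x \<in> V \<and> V \<subseteq> U \<and> s \<in> carrier (sections F V) \<and>
                       restrict \<sigma> V = germs X F V s},
         monoid.mult = (\<lambda>\<sigma> \<tau>. \<lambda>x\<in>U. \<sigma> x \<otimes>\<^bsub>stalk X F x\<^esub> \<tau> x),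
         one = (\<lambda>x\<in>U. \<one>\<^bsub>stalk X F x\<^esub>)\<rparr>),
      restr = (\<lambda>U V \<sigma>. restrict \<sigma> V)\<rparr>"


section \<open>Direct and inverse image\<close>

definition direct_image ::
  "'x topology \<Rightarrow> ('x \<Rightarrow> 'y) \<Rightarrow> ('x, 'u) presheaf \<Rightarrow> ('y, 'u) presheaf" where
  "direct_image X f F =
     \<lparr>sections = (\<lambda>V. sections F (preimage X f V)),
      restr = (\<lambda>V V'. restr F (preimage X f V) (preimage X f V'))\<rparr>"

definition nbhds_of_image :: "'z topology \<Rightarrow> ('y \<Rightarrow> 'z) \<Rightarrow> 'y set \<Rightarrow> 'z set set" where
  "nbhds_of_image Z f V = {W. openin Z W \<and> f ` V \<subseteq> W}"

text \<open>\<open>V \<mapsto> colim S(W)\<close>, where \<open>W\<close> runs over the open neighbourhoods of \<open>f(V)\<close>.\<close>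

definition inverse_image_presheaf ::
  "'z topology \<Rightarrow> ('y \<Rightarrow> 'z) \<Rightarrow> ('z, 'w) presheaf \<Rightarrow> ('y, ('z set \<times> 'w) set) presheaf" where
  "inverse_image_presheaf Z f S =
     \<lparr>sections = (\<lambda>V. colim S (nbhds_of_image Z f V)),
      restr = (\<lambda>V V' a. \<Union>(W, s)\<in>a. germ S (nbhds_of_image Z f V') W s)\<rparr>"

definition inverse_image ::
  "'y topology \<Rightarrow> 'z topology \<Rightarrow> ('y \<Rightarrow> 'z) \<Rightarrow> ('z, 'w) presheaf \<Rightarrow>
   ('y, 'y \<Rightarrow> ('y set \<times> ('z set \<times> 'w) set) set) presheaf" where
  "inverse_image Y Z f S = sheafify Y (inverse_image_presheaf Z f S)"

text \<open>The unit of the adjunction, \<open>S(W) \<rightarrow> (f\<^sub>* f\<inverse> S)(W) = (f\<inverse> S)(f\<inverse>(W))\<close>.\<close>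

definition inverse_image_unit ::
  "'y topology \<Rightarrow> 'z topology \<Rightarrow> ('y \<Rightarrow> 'z) \<Rightarrow> ('z, 'w) presheaf \<Rightarrow> 'z set \<Rightarrow> 'w \<Rightarrow>
   'y \<Rightarrow> ('y set \<times> ('z set \<times> 'w) set) set" where
  "inverse_image_unit Y Z f S W s =
     germs Y (inverse_image_presheaf Z f S) (preimage Y f W)
       (germ S (nbhds_of_image Z f (preimage Y f W)) W s)"


section \<open>Injective resolutions and cohomology sheaves\<close>

text \<open>
  The category is that of sheaves with sections in the type \<open>'u\<close>, which plays the role of a
  universe.
\<close>

definition injective_sheaf :: "'x topology \<Rightarrow> ('x, 'u) presheaf \<Rightarrow> bool" where
  "injective_sheaf X I \<longleftrightarrow>
     sheaf X I \<and>
     (\<forall>(A :: ('x, 'u) presheaf) (B :: ('x, 'u) presheaf) m f.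
        sheaf X A \<and> sheaf X B \<and> sheaf_mono X A B m \<and> sheaf_hom X A I f \<longrightarrow>
        (\<exists>g. sheaf_hom X B I g \<and>
             (\<forall>U. openin X U \<longrightarrow> (\<forall>a \<in> carrier (sections A U). g U (m U a) = f U a))))"

definition kernel_sections ::
  "('x, 'u) presheaf \<Rightarrow> ('x, 'w) presheaf \<Rightarrow> ('x set \<Rightarrow> 'u \<Rightarrow> 'w) \<Rightarrow> 'x set \<Rightarrow> 'u set" where
  "kernel_sections F G \<eta> U = kernel (sections F U) (sections G U) (\<eta> U)"

text \<open>Sections of the image sheaf, that is, sections that locally have a preimage.\<close>

definition image_sections ::
  "'x topology \<Rightarrow> ('x, 'u) presheaf \<Rightarrow> ('x, 'w) presheaf \<Rightarrow> ('x set \<Rightarrow> 'u \<Rightarrow> 'w) \<Rightarrow>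
   'x set \<Rightarrow> 'w set" where
  "image_sections X F G \<eta> U =
     {s \<in> carrier (sections G U).
        \<forall>x\<in>U. \<exists>V. openin X V \<and> x \<in> V \<and> V \<subseteq> U \<and>
                  restr G U V s \<in> \<eta> V ` carrier (sections F V)}"

record ('x, 'u) cochain =
  obj :: "nat \<Rightarrow> ('x, 'u) presheaf"
  diff :: "nat \<Rightarrow> 'x set \<Rightarrow> 'u \<Rightarrow> 'u"

definition injective_resolution ::
  "'x topology \<Rightarrow> ('x, 'u) presheaf \<Rightarrow> ('x set \<Rightarrow> 'u \<Rightarrow> 'u) \<Rightarrow> ('x, 'u) cochain \<Rightarrow> bool" where
  "injective_resolution X G \<epsilon> I \<longleftrightarrow>
     (\<forall>n. injective_sheaf X (obj I n)) \<and>
     sheaf_hom X G (obj I 0) \<epsilon> \<and>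
     (\<forall>n. sheaf_hom X (obj I n) (obj I (Suc n)) (diff I n)) \<and>
     (\<forall>U. openin X U \<longrightarrow>
        kernel_sections G (obj I 0) \<epsilon> U = {\<one>\<^bsub>sections G U\<^esub>} \<and>
        kernel_sections (obj I 0) (obj I 1) (diff I 0) U = image_sections X G (obj I 0) \<epsilon> U \<and>
        (\<forall>n. kernel_sections (obj I (Suc n)) (obj I (Suc (Suc n))) (diff I (Suc n)) U =
             image_sections X (obj I n) (obj I (Suc n)) (diff I n) U))"

definition cocycles :: "('x, 'u) cochain \<Rightarrow> nat \<Rightarrow> 'x set \<Rightarrow> 'u set" where
  "cocycles C n = kernel_sections (obj C n) (obj C (Suc n)) (diff C n)"

text \<open>The complex is zero in negative degrees.\<close>

definition coboundaries :: "'x topology \<Rightarrow> ('x, 'u) cochain \<Rightarrow> nat \<Rightarrow> 'x set \<Rightarrow> 'u set" where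
  "coboundaries X C n U =
     (case n of
        0 \<Rightarrow> {\<one>\<^bsub>sections (obj C 0) U\<^esub>}
      | Suc m \<Rightarrow> image_sections X (obj C m) (obj C (Suc m)) (diff C m) U)"

definition cohomology_presheaf ::
  "'x topology \<Rightarrow> ('x, 'u) cochain \<Rightarrow> nat \<Rightarrow> ('x, 'u set) presheaf" where
  "cohomology_presheaf X C n =
     \<lparr>sections = (\<lambda>U.
        (sections (obj C n) U\<lparr>carrier := cocycles C n U\<rparr>) Mod coboundaries X C n U),
      restr = (\<lambda>U V a. coboundaries X C n V <#>\<^bsub>sections (obj C n) V\<^esub> (restr (obj C n) U V ` a))\<rparr>"

definition cohomology_sheaf ::
  "'x topology \<Rightarrow> ('x, 'u) cochain \<Rightarrow> nat \<Rightarrow> ('x, 'x \<Rightarrow> ('x set \<times> 'u set) set) presheaf" where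
  "cohomology_sheaf X C n = sheafify X (cohomology_presheaf X C n)"

definition cohomology_class ::
  "'x topology \<Rightarrow> ('x, 'u) cochain \<Rightarrow> nat \<Rightarrow> 'x set \<Rightarrow> 'u \<Rightarrow> 'x \<Rightarrow> ('x set \<times> 'u set) set" where
  "cohomology_class X C n U c =
     germs X (cohomology_presheaf X C n) U (coboundaries X C n U #>\<^bsub>sections (obj C n) U\<^esub> c)"


section \<open>Higher direct images\<close>

definition direct_image_complex ::
  "'x topology \<Rightarrow> ('x \<Rightarrow> 'y) \<Rightarrow> ('x, 'u) cochain \<Rightarrow> ('y, 'u) cochain" where
  "direct_image_complex X f C =
     \<lparr>obj = (\<lambda>n. direct_image X f (obj C n)),
      diff = (\<lambda>n V. diff C n (preimage X f V))\<rparr>"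

text \<open>
  The \<open>n\<close>-th right derived functor of \<open>f\<^sub>*\<close> on a sheaf with injective resolution \<open>I\<close>:
  the \<open>n\<close>-th cohomology sheaf of \<open>f\<^sub>* I\<close>.
\<close>

definition higher_direct_image ::
  "'x topology \<Rightarrow> 'y topology \<Rightarrow> ('x \<Rightarrow> 'y) \<Rightarrow> ('x, 'u) cochain \<Rightarrow> nat \<Rightarrow>
   ('y, 'y \<Rightarrow> ('y set \<times> 'u set) set) presheaf" where
  "higher_direct_image X Y f I n = cohomology_sheaf Y (direct_image_complex X f I) n"

text \<open>
  Every open \<open>W\<close> in the filtrum satisfies \<open>\<phi>\<inverse>(\<psi>\<inverse>(W)) \<subseteq> i\<inverse>(W)\<close>, because \<open>\<psi>(\<phi>(x)) \<subseteq> U(x)\<close> and \<open>W\<close> is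
  closed under passing to larger filters. So restriction of sections is a morphism
  \<open>i\<^sub>* I \<rightarrow> \<psi>\<^sub>* \<phi>\<^sub>* I\<close> of complexes, which induces \<open>R\<^sup>n i\<^sub>* G \<rightarrow> \<psi>\<^sub>* R\<^sup>n \<phi>\<^sub>* G\<close>. The canonical morphism is the
  adjoint \<open>\<theta>\<close> of this one: it sends the class of a cocycle \<open>c\<close> over \<open>i\<inverse>(W)\<close> to the class of its
  restriction to \<open>\<phi>\<inverse>(\<psi>\<inverse>(W))\<close>. As such classes generate the inverse image sheaf locally, the
  condition determines \<open>\<theta>\<close>.
\<close>

definition canonical_comparison ::
  "'x topology \<Rightarrow> 'y topology \<Rightarrow> ('x \<Rightarrow> 'y) \<Rightarrow> ('x, 'u) cochain \<Rightarrow> nat \<Rightarrow>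
   ('y set \<Rightarrow>
     ('y \<Rightarrow> ('y set \<times> ('x set set set \<times>
        ('x set set \<Rightarrow> ('x set set set \<times> 'u set) set)) set) set) \<Rightarrow>
     ('y \<Rightarrow> ('y set \<times> 'u set) set)) \<Rightarrow> bool" where
  "canonical_comparison X Y \<phi> I n \<theta> \<longleftrightarrow>
     (\<forall>W. openin (filt X) W \<longrightarrow>
       (\<forall>c \<in> cocycles (direct_image_complex X (nbhd_filter X) I) n W.
          \<theta> (preimage Y (psi X Y \<phi>) W)
            (inverse_image_unit Y (filt X) (psi X Y \<phi>)
               (higher_direct_image X (filt X) (nbhd_filter X) I n) W
               (cohomology_class (filt X) (direct_image_complex X (nbhd_filter X) I) n W c)) =
          cohomology_class Y (direct_image_complex X \<phi> I) n (preimage Y (psi X Y \<phi>) W)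
            (restr (obj I n) (preimage X (nbhd_filter X) W)
               (preimage X \<phi> (preimage Y (psi X Y \<phi>) W)) c)))"

end

theory Submission
  imports Defs
begin

text \<open>
  Both sheaves are sheafifications, so it suffices to compare stalks. The sets \<open>D(U)\<close> with
  \<open>U \<in> \<psi>(y)\<close> form a basis of neighbourhoods of \<open>\<psi>(y)\<close> and \<open>i\<inverse>(D(U)) = U\<close>, hence the stalk of
  \<open>R\<^sup>n i\<^sub>* G\<close> at \<open>\<psi>(y)\<close> is the direct limit of \<open>H\<^sup>n(I(U))\<close> over \<open>U \<in> \<psi>(y)\<close>, where \<open>I\<close> is the
  resolution. The sets \<open>\<phi>\<inverse>(V)\<close> with
  \<open>y \<in> V\<close> are cofinal in \<open>\<psi>(y)\<close>, so this is also the direct limit of \<open>H\<^sup>n(I(\<phi>\<inverse>(V)))\<close>, which is the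
  stalk of \<open>R\<^sup>n \<phi>\<^sub>* G\<close> at \<open>y\<close>.
\<close>

section \<open>Presheaves and direct limits\<close>

text \<open>Two features of the definitions shape the proof. The inverse image is the associated
  sheaf of a presheaf whose sections are classes of sections of another associated sheaf, so they
  come from the cohomology presheaf on the filtrum only locally, and no evident map of presheaves
  leads from there to the cohomology presheaf on \<open>Y\<close>. The isomorphism is therefore
  built from a relation between local sections: the two images of one section over an open
  \<open>W\<close> of the filtrum. What remains is injectivity and surjectivity at each
  \<open>y\<close>, stated in terms of elements. Secondly, coboundaries are sections of the image
  sheaf, hence of the form \<open>diff b\<close> only locally. A cocycle whose class vanishes over
  \<open>V\<close> need not be a boundary over the whole of \<open>\<phi>\<inverse>(V)\<close>, so
  \<open>V\<close> must first shrink to a neighbourhood \<open>V'\<close> of \<open>y\<close> on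
  which some \<open>b\<close> exists. Surjectivity needs no shrinking: the same cocycle over
  \<open>\<phi>\<inverse>(V)\<close> is already a cocycle over
  \<open>D(\<phi>\<inverse>(V))\<close>.\<close>

lemma presheaf_group: "is_presheaf X F \<Longrightarrow> openin X U \<Longrightarrow> comm_group (sections F U)"
  by (simp add: is_presheaf_def)

lemma presheaf_is_group: "is_presheaf X F \<Longrightarrow> openin X U \<Longrightarrow> group (sections F U)"
  by (simp add: presheaf_group comm_group.axioms(2))

lemma presheaf_hom:
  "is_presheaf X F \<Longrightarrow> openin X U \<Longrightarrow> openin X V \<Longrightarrow> V \<subseteq> U \<Longrightarrow>
     restr F U V \<in> hom (sections F U) (sections F V)"
  by (simp add: is_presheaf_def)

lemma presheaf_restr_id:
  "is_presheaf X F \<Longrightarrow> openin X U \<Longrightarrow> s \<in> carrier (sections F U) \<Longrightarrow> restr F U U s = s"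
  by (simp add: is_presheaf_def)

lemma presheaf_restr_restr:
  "is_presheaf X F \<Longrightarrow> openin X U \<Longrightarrow> openin X V \<Longrightarrow> openin X W \<Longrightarrow> W \<subseteq> V \<Longrightarrow> V \<subseteq> U \<Longrightarrow>
     s \<in> carrier (sections F U) \<Longrightarrow> restr F V W (restr F U V s) = restr F U W s"
  by (simp add: is_presheaf_def)

lemma presheaf_restr_closed:
  "is_presheaf X F \<Longrightarrow> openin X U \<Longrightarrow> openin X V \<Longrightarrow> V \<subseteq> U \<Longrightarrow>
     s \<in> carrier (sections F U) \<Longrightarrow> restr F U V s \<in> carrier (sections F V)"
  by (rule hom_in_carrier[OF presheaf_hom])

lemma presheaf_restr_mult:
  "is_presheaf X F \<Longrightarrow> openin X U \<Longrightarrow> openin X V \<Longrightarrow> V \<subseteq> U \<Longrightarrow>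
     s \<in> carrier (sections F U) \<Longrightarrow> t \<in> carrier (sections F U) \<Longrightarrow>
     restr F U V (s \<otimes>\<^bsub>sections F U\<^esub> t) = restr F U V s \<otimes>\<^bsub>sections F V\<^esub> restr F U V t"
  by (rule hom_mult[OF presheaf_hom])

lemma presheaf_restr_one:
  "is_presheaf X F \<Longrightarrow> openin X U \<Longrightarrow> openin X V \<Longrightarrow> V \<subseteq> U \<Longrightarrow>
     restr F U V \<one>\<^bsub>sections F U\<^esub> = \<one>\<^bsub>sections F V\<^esub>"
  by (rule hom_one[OF presheaf_hom]) (simp_all add: presheaf_is_group)

lemma presheaf_mult_closed:
  "is_presheaf X F \<Longrightarrow> openin X U \<Longrightarrow> s \<in> carrier (sections F U) \<Longrightarrow>
     t \<in> carrier (sections F U) \<Longrightarrow> s \<otimes>\<^bsub>sections F U\<^esub> t \<in> carrier (sections F U)"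
  by (rule monoid.m_closed) (simp_all add: presheaf_is_group group.is_monoid)

lemma presheaf_one_closed:
  "is_presheaf X F \<Longrightarrow> openin X U \<Longrightarrow> \<one>\<^bsub>sections F U\<^esub> \<in> carrier (sections F U)"
  by (rule monoid.one_closed) (simp add: presheaf_is_group group.is_monoid)

lemma openin_preimage: "continuous_map X Y f \<Longrightarrow> openin Y V \<Longrightarrow> openin X (preimage X f V)"
  unfolding preimage_def by (rule openin_continuous_map_preimage)

lemma preimage_mono: "V \<subseteq> V' \<Longrightarrow> preimage X f V \<subseteq> preimage X f V'"
  by (auto simp: preimage_def)

text \<open>Two instances matter: \<open>nbhd_filter X x\<close>, which gives stalks, and
  \<open>nbhds_of_image Z f V\<close>, which gives the sections of the inverse image presheaf.
  Closure under intersection makes the system directed, and nonemptiness provides the unit.\<close>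

locale directed_colimit =
  fixes X :: "'x topology" and F :: "('x, 'u) presheaf" and N :: "'x set set"
  assumes presheaf: "is_presheaf X F"
    and opens: "U \<in> N \<Longrightarrow> openin X U"
    and nonempty: "N \<noteq> {}"
    and Int_closed: "U \<in> N \<Longrightarrow> V \<in> N \<Longrightarrow> U \<inter> V \<in> N"
begin

lemma restr_closed:
  "U \<in> N \<Longrightarrow> V \<in> N \<Longrightarrow> V \<subseteq> U \<Longrightarrow> s \<in> carrier (sections F U) \<Longrightarrow>
     restr F U V s \<in> carrier (sections F V)"
  using presheaf_restr_closed[OF presheaf opens opens] .

lemma restr_restr:
  "U \<in> N \<Longrightarrow> V \<in> N \<Longrightarrow> W \<in> N \<Longrightarrow> W \<subseteq> V \<Longrightarrow> V \<subseteq> U \<Longrightarrow>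
     s \<in> carrier (sections F U) \<Longrightarrow> restr F V W (restr F U V s) = restr F U W s"
  using presheaf_restr_restr[OF presheaf opens opens opens] .

lemma germ_refl:
  assumes "U \<in> N" "s \<in> carrier (sections F U)"
  shows "(U, s) \<in> germ F N U s"
  using assms by (auto simp: germ_def)

text \<open>This is transitivity of the relation of having a common restriction: two witnesses
  \<open>W\<close> and \<open>W'\<close> are replaced by their intersection. Since germs are sets of
  pairs, one inclusion suffices; exchanging the two pairs gives the other.\<close>

lemma germ_restr_agree:
  assumes "U \<in> N" "s \<in> carrier (sections F U)" "V \<in> N" "t \<in> carrier (sections F V)"
    "W \<in> N" "W \<subseteq> U \<inter> V" "restr F U W s = restr F V W t"
  shows "germ F N U s \<subseteq> germ F N V t"
proof (clarsimp simp: germ_def)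
  fix U' s' W'
  assume U': "U' \<in> N" "s' \<in> carrier (sections F U')"
    and W': "W' \<in> N" "W' \<subseteq> U" "W' \<subseteq> U'" "restr F U W' s = restr F U' W' s'"
  let ?W = "W \<inter> W'"
  have W: "?W \<in> N" using assms W' Int_closed by blast
  have "restr F V ?W t = restr F W ?W (restr F V W t)"
    using restr_restr[of V W ?W t] assms W by simp
  also have "\<dots> = restr F U ?W s"
    using restr_restr[of U W ?W s] assms W by simp
  also have "\<dots> = restr F W' ?W (restr F U W' s)"
    using restr_restr[of U W' ?W s] assms W W' by simp
  also have "\<dots> = restr F U' ?W s'"
    using restr_restr[of U' W' ?W s'] U' W' W by simp
  finally show "\<exists>W\<in>N. W \<subseteq> V \<and> W \<subseteq> U' \<and> restr F V W t = restr F U' W s'"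
    using W W' assms by (intro bexI[of _ ?W]) auto
qed

lemma germ_eq_iff:
  assumes "U \<in> N" "s \<in> carrier (sections F U)" "V \<in> N" "t \<in> carrier (sections F V)"
  shows "germ F N U s = germ F N V t \<longleftrightarrow> (\<exists>W\<in>N. W \<subseteq> U \<inter> V \<and> restr F U W s = restr F V W t)"
proof
  assume "germ F N U s = germ F N V t"
  then have "(V, t) \<in> germ F N U s" using germ_refl assms by simp
  then show "\<exists>W\<in>N. W \<subseteq> U \<inter> V \<and> restr F U W s = restr F V W t" by (simp add: germ_def)
next
  assume "\<exists>W\<in>N. W \<subseteq> U \<inter> V \<and> restr F U W s = restr F V W t"
  then obtain W where W: "W \<in> N" "W \<subseteq> U \<inter> V" "restr F U W s = restr F V W t" by blast
  show "germ F N U s = germ F N V t"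
    using germ_restr_agree[OF assms W] germ_restr_agree[OF assms(3,4,1,2) W(1)] W by auto
qed

lemma germ_eqI:
  assumes "U \<in> N" "s \<in> carrier (sections F U)" "V \<in> N" "t \<in> carrier (sections F V)"
    "W \<in> N" "W \<subseteq> U" "W \<subseteq> V" "restr F U W s = restr F V W t"
  shows "germ F N U s = germ F N V t"
  using germ_eq_iff[OF assms(1-4)] assms(5-) by blast

lemma germ_restr:
  assumes "U \<in> N" "s \<in> carrier (sections F U)" "V \<in> N" "V \<subseteq> U"
  shows "germ F N V (restr F U V s) = germ F N U s"
  using assms restr_restr[of U V V s] by (intro germ_eqI[where W = V] restr_closed) auto

lemma germ_closed:
  "U \<in> N \<Longrightarrow> s \<in> carrier (sections F U) \<Longrightarrow> germ F N U s \<in> carrier (colim F N)"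
  by (auto simp: colim_def)

lemma colimE:
  assumes "a \<in> carrier (colim F N)"
  obtains U s where "U \<in> N" "s \<in> carrier (sections F U)" "a = germ F N U s"
  using assms by (auto simp: colim_def)

lemma germ_memE:
  assumes "U \<in> N" "s \<in> carrier (sections F U)" "(V, t) \<in> germ F N U s"
  shows "V \<in> N" "t \<in> carrier (sections F V)" "germ F N V t = germ F N U s"
proof -
  show V: "V \<in> N" "t \<in> carrier (sections F V)"
    using assms by (simp_all add: germ_def)
  have "\<exists>W\<in>N. W \<subseteq> U \<inter> V \<and> restr F U W s = restr F V W t"
    using assms(3) by (simp add: germ_def)
  then show "germ F N V t = germ F N U s"
    using germ_eq_iff[OF assms(1,2) V] by simp
qed

text \<open>Operations on classes are unions over all representatives. A class contains its own
  representative, so the union is not empty, and a constant family collapses to its value. Every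
  such operation can thus be evaluated at one representative.\<close>

lemma Union_germ_const:
  assumes "U \<in> N" "s \<in> carrier (sections F U)"
    and "\<And>V t. V \<in> N \<Longrightarrow> t \<in> carrier (sections F V) \<Longrightarrow> germ F N V t = germ F N U s \<Longrightarrow> h V t = c"
  shows "(\<Union>(V, t)\<in>germ F N U s. h V t) = c"
proof -
  have "h V t = c" if "(V, t) \<in> germ F N U s" for V t
    using germ_memE[OF assms(1,2) that] assms(3) by blast
  then show ?thesis
    using germ_refl[OF assms(1,2)] by (auto split: prod.splits)
qed

text \<open>Well-definedness of the product: if representatives change, the equality of the first
  factors is witnessed on some \<open>A\<close>, that of the second factors on some
  \<open>B\<close>, and the two products agree on \<open>A \<inter> B\<close>.\<close>

lemma germ_mult_Int:
  assumes U: "U \<in> N" "s \<in> carrier (sections F U)" and V: "V \<in> N" "t \<in> carrier (sections F V)"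
  shows "germ F N U s \<otimes>\<^bsub>colim F N\<^esub> germ F N V t =
     germ F N (U \<inter> V)
       (restr F U (U \<inter> V) s \<otimes>\<^bsub>sections F (U \<inter> V)\<^esub> restr F V (U \<inter> V) t)"
proof -
  let ?p = "\<lambda>U s V t. germ F N (U \<inter> V)
       (restr F U (U \<inter> V) s \<otimes>\<^bsub>sections F (U \<inter> V)\<^esub> restr F V (U \<inter> V) t)"
  have *: "?p U' s' V' t' = ?p U s V t"
    if U': "U' \<in> N" "s' \<in> carrier (sections F U')" "germ F N U' s' = germ F N U s"
      and V': "V' \<in> N" "t' \<in> carrier (sections F V')" "germ F N V' t' = germ F N V t"
    for U' s' V' t'
  proof -
    obtain A where A: "A \<in> N" "A \<subseteq> U'" "A \<subseteq> U" "restr F U' A s' = restr F U A s"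
      using U' U germ_eq_iff by (metis le_inf_iff)
    obtain B where B: "B \<in> N" "B \<subseteq> V'" "B \<subseteq> V" "restr F V' B t' = restr F V B t"
      using V' V germ_eq_iff by (metis le_inf_iff)
    let ?W = "A \<inter> B"
    have W: "?W \<in> N" using A B Int_closed by blast
    \<comment> \<open>Over \<open>A \<inter> B\<close> the product depends on \<open>s1\<close> and
      \<open>t1\<close> only through their restrictions to \<open>A\<close> and to \<open>B\<close>.
      These restrictions are the same for the old and the new representatives.\<close>
    have *: "restr F (U1 \<inter> V1) ?W (restr F U1 (U1 \<inter> V1) s1 \<otimes>\<^bsub>sections F (U1 \<inter> V1)\<^esub> restr F V1 (U1 \<inter> V1) t1)
        = restr F A ?W (restr F U1 A s1) \<otimes>\<^bsub>sections F ?W\<^esub> restr F B ?W (restr F V1 B t1)"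
      if "U1 \<in> N" "V1 \<in> N" "s1 \<in> carrier (sections F U1)" "t1 \<in> carrier (sections F V1)"
        "A \<subseteq> U1" "B \<subseteq> V1" for U1 V1 s1 t1
    proof -
      have UV: "U1 \<inter> V1 \<in> N" "?W \<subseteq> U1 \<inter> V1" using that Int_closed by auto
      have "restr F (U1 \<inter> V1) ?W (restr F U1 (U1 \<inter> V1) s1 \<otimes>\<^bsub>sections F (U1 \<inter> V1)\<^esub> restr F V1 (U1 \<inter> V1) t1)
        = restr F (U1 \<inter> V1) ?W (restr F U1 (U1 \<inter> V1) s1) \<otimes>\<^bsub>sections F ?W\<^esub>
          restr F (U1 \<inter> V1) ?W (restr F V1 (U1 \<inter> V1) t1)"
        using that UV W by (intro presheaf_restr_mult[OF presheaf] opens restr_closed) auto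
      also have "\<dots> = restr F U1 ?W s1 \<otimes>\<^bsub>sections F ?W\<^esub> restr F V1 ?W t1"
        using that UV W by (simp add: restr_restr)
      also have "\<dots> = restr F A ?W (restr F U1 A s1) \<otimes>\<^bsub>sections F ?W\<^esub> restr F B ?W (restr F V1 B t1)"
        using that A(1) B(1) W by (simp add: restr_restr)
      finally show ?thesis .
    qed
    show ?thesis
    proof (rule germ_eqI[where W = ?W])
      show "restr F (U' \<inter> V') ?W (restr F U' (U' \<inter> V') s' \<otimes>\<^bsub>sections F (U' \<inter> V')\<^esub> restr F V' (U' \<inter> V') t')
        = restr F (U \<inter> V) ?W (restr F U (U \<inter> V) s \<otimes>\<^bsub>sections F (U \<inter> V)\<^esub> restr F V (U \<inter> V) t)"
        using *[of U' V' s' t'] *[of U V s t] U V U' V' A B by simp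
    qed (use U V U' V' A B W Int_closed in
        \<open>auto intro!: presheaf_mult_closed[OF presheaf] opens restr_closed\<close>)
  qed
  have "(\<Union>(V', t')\<in>germ F N V t. ?p U' s' V' t') = ?p U s V t"
    if "U' \<in> N" "s' \<in> carrier (sections F U')" "germ F N U' s' = germ F N U s" for U' s'
    by (rule Union_germ_const[OF V]) (rule *[OF that])
  then have "(\<Union>(U', s')\<in>germ F N U s. \<Union>(V', t')\<in>germ F N V t. ?p U' s' V' t') = ?p U s V t"
    by (rule Union_germ_const[OF U])
  then show ?thesis by (simp add: colim_def)
qed

lemma germ_mult:
  assumes "U \<in> N" "s \<in> carrier (sections F U)" "t \<in> carrier (sections F U)"
  shows "germ F N U (s \<otimes>\<^bsub>sections F U\<^esub> t) = germ F N U s \<otimes>\<^bsub>colim F N\<^esub> germ F N U t"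
  using germ_mult_Int[of U s U t] assms presheaf_restr_id[OF presheaf opens] by simp

lemma germ_one_eq:
  assumes "U \<in> N" "V \<in> N"
  shows "germ F N U \<one>\<^bsub>sections F U\<^esub> = germ F N V \<one>\<^bsub>sections F V\<^esub>"
proof (rule germ_eqI[where W = "U \<inter> V"])
  show "restr F U (U \<inter> V) \<one>\<^bsub>sections F U\<^esub> = restr F V (U \<inter> V) \<one>\<^bsub>sections F V\<^esub>"
    using assms Int_closed by (simp add: presheaf_restr_one[OF presheaf] opens)
qed (use assms Int_closed presheaf_one_closed[OF presheaf opens] in auto)

lemma germ_one:
  assumes "U \<in> N"
  shows "germ F N U \<one>\<^bsub>sections F U\<^esub> = \<one>\<^bsub>colim F N\<^esub>"
proof -
  have "(\<Union>V\<in>N. germ F N V \<one>\<^bsub>sections F V\<^esub>) = germ F N U \<one>\<^bsub>sections F U\<^esub>"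
    using germ_one_eq assms by blast
  then show ?thesis by (simp add: colim_def)
qed

text \<open>Restriction to the intersection does not change a germ. Identities between elements of
  the direct limit thereby reduce to identities in a single group of sections.\<close>

lemma colim_common_rep:
  assumes "a \<in> carrier (colim F N)" "b \<in> carrier (colim F N)"
  obtains U s t where "U \<in> N" "s \<in> carrier (sections F U)" "t \<in> carrier (sections F U)"
    "a = germ F N U s" "b = germ F N U t"
proof -
  obtain U s where U: "U \<in> N" "s \<in> carrier (sections F U)" "a = germ F N U s"
    using assms(1) by (rule colimE)
  obtain V t where V: "V \<in> N" "t \<in> carrier (sections F V)" "b = germ F N V t"
    using assms(2) by (rule colimE)
  have W: "U \<inter> V \<in> N" using U V Int_closed by blast
  show ?thesis
    using that[of "U \<inter> V" "restr F U (U \<inter> V) s" "restr F V (U \<inter> V) t"] U V W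
    by (simp add: germ_restr restr_closed)
qed

lemma colim_comm_group: "comm_group (colim F N)"
proof (rule comm_groupI)
  obtain U0 where U0: "U0 \<in> N" using nonempty by blast
  show one: "\<one>\<^bsub>colim F N\<^esub> \<in> carrier (colim F N)"
    using germ_one[OF U0] germ_closed[OF U0 presheaf_one_closed[OF presheaf opens[OF U0]]] by simp
  fix a assume a: "a \<in> carrier (colim F N)"
  obtain U s where U: "U \<in> N" "s \<in> carrier (sections F U)" "a = germ F N U s"
    using a by (rule colimE)
  interpret S: comm_group "sections F U" using presheaf_group[OF presheaf opens[OF U(1)]] .
  show "\<one>\<^bsub>colim F N\<^esub> \<otimes>\<^bsub>colim F N\<^esub> a = a"
    using germ_mult[of U "\<one>\<^bsub>sections F U\<^esub>" s] U by (simp add: germ_one)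
  show "\<exists>b\<in>carrier (colim F N). b \<otimes>\<^bsub>colim F N\<^esub> a = \<one>\<^bsub>colim F N\<^esub>"
    using germ_mult[of U "inv\<^bsub>sections F U\<^esub> s" s] U
    by (intro bexI[of _ "germ F N U (inv\<^bsub>sections F U\<^esub> s)"]) (simp_all add: germ_one germ_closed)
next
  fix a b assume ab: "a \<in> carrier (colim F N)" "b \<in> carrier (colim F N)"
  obtain U s t where U: "U \<in> N" "s \<in> carrier (sections F U)" "t \<in> carrier (sections F U)"
    "a = germ F N U s" "b = germ F N U t"
    using ab by (rule colim_common_rep)
  interpret S: comm_group "sections F U" using presheaf_group[OF presheaf opens[OF U(1)]] .
  show "a \<otimes>\<^bsub>colim F N\<^esub> b \<in> carrier (colim F N)"
    using U by (simp add: germ_mult[symmetric] germ_closed)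
  show "a \<otimes>\<^bsub>colim F N\<^esub> b = b \<otimes>\<^bsub>colim F N\<^esub> a"
    using U by (simp add: germ_mult[symmetric] S.m_comm)
  fix c assume c: "c \<in> carrier (colim F N)"
  obtain V r where V: "V \<in> N" "r \<in> carrier (sections F V)" "c = germ F N V r"
    using c by (rule colimE)
  let ?W = "U \<inter> V"
  have W: "?W \<in> N" using U V Int_closed by blast
  interpret W: comm_group "sections F ?W" using presheaf_group[OF presheaf opens[OF W]] .
  have reps: "a = germ F N ?W (restr F U ?W s)" "b = germ F N ?W (restr F U ?W t)"
    "c = germ F N ?W (restr F V ?W r)"
    using U V W by (simp_all add: germ_restr)
  have cl: "restr F U ?W s \<in> carrier (sections F ?W)" "restr F U ?W t \<in> carrier (sections F ?W)"
    "restr F V ?W r \<in> carrier (sections F ?W)"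
    using U V W by (simp_all add: restr_closed)
  show "a \<otimes>\<^bsub>colim F N\<^esub> b \<otimes>\<^bsub>colim F N\<^esub> c = a \<otimes>\<^bsub>colim F N\<^esub> (b \<otimes>\<^bsub>colim F N\<^esub> c)"
    unfolding reps using W cl by (simp add: germ_mult[symmetric] W.m_assoc)
qed

lemma germ_hom: "U \<in> N \<Longrightarrow> germ F N U \<in> hom (sections F U) (colim F N)"
  by (rule homI) (simp_all add: germ_closed germ_mult)

end

section \<open>Sheafification\<close>

lemma mem_nbhd_filter: "U \<in> nbhd_filter X x \<longleftrightarrow> openin X U \<and> x \<in> U"
  by (simp add: nbhd_filter_def)

lemma stalk_colimit:
  assumes "is_presheaf X F" "openin X U" "x \<in> U"
  shows "directed_colimit X F (nbhd_filter X x)"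
proof
  have "U \<in> nbhd_filter X x" using assms(2,3) by (simp add: mem_nbhd_filter)
  then show "nbhd_filter X x \<noteq> {}" by blast
qed (simp_all add: assms(1) mem_nbhd_filter openin_Int)

lemma germs_apply: "x \<in> U \<Longrightarrow> germs X F U s x = germ F (nbhd_filter X x) U s"
  by (simp add: germs_def)

lemma sheafify_carrierE:
  assumes "\<sigma> \<in> carrier (sections (sheafify X F) U)" "x \<in> U"
  obtains V s where "openin X V" "x \<in> V" "V \<subseteq> U" "s \<in> carrier (sections F V)"
    "\<forall>y\<in>V. \<sigma> y = germ F (nbhd_filter X y) V s"
proof -
  obtain V s where V: "openin X V" "x \<in> V" "V \<subseteq> U" "s \<in> carrier (sections F V)"
    "restrict \<sigma> V = germs X F V s"
    using assms by (auto simp: sheafify_def)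
  have "\<sigma> y = germ F (nbhd_filter X y) V s" if "y \<in> V" for y
    using fun_cong[OF V(5), of y] that by (simp add: germs_def)
  then show ?thesis using that[OF V(1-4)] by simp
qed

text \<open>A weaker criterion that is easier to verify than the definition. The neighbourhood
  \<open>V\<close> may stick out of \<open>U\<close>, since \<open>s\<close> can be restricted to
  \<open>V \<inter> U\<close>, and membership of the values in the stalks follows from local
  representability.\<close>

lemma sheafify_carrier_iff:
  assumes F: "is_presheaf X F" and U: "openin X U"
  shows "\<sigma> \<in> carrier (sections (sheafify X F) U) \<longleftrightarrow> \<sigma> \<in> extensional U \<and>
    (\<forall>x\<in>U. \<exists>V s. openin X V \<and> x \<in> V \<and> s \<in> carrier (sections F V) \<and>
       (\<forall>y\<in>V \<inter> U. \<sigma> y = germ F (nbhd_filter X y) V s))" (is "?l \<longleftrightarrow> ?r")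
proof
  assume l: ?l
  then have "\<sigma> \<in> extensional U" by (simp add: sheafify_def PiE_def)
  moreover have "\<exists>V s. openin X V \<and> x \<in> V \<and> s \<in> carrier (sections F V) \<and>
       (\<forall>y\<in>V \<inter> U. \<sigma> y = germ F (nbhd_filter X y) V s)" if x: "x \<in> U" for x
  proof -
    obtain V s where "openin X V" "x \<in> V" "V \<subseteq> U" "s \<in> carrier (sections F V)"
      "\<forall>y\<in>V. \<sigma> y = germ F (nbhd_filter X y) V s"
      using l x by (rule sheafify_carrierE)
    then show ?thesis by (intro exI[of _ V] exI[of _ s]) simp
  qed
  ultimately show ?r by simp
next
  assume r: ?r
  have *: "\<exists>V s. openin X V \<and> x \<in> V \<and> V \<subseteq> U \<and> s \<in> carrier (sections F V) \<and>
      restrict \<sigma> V = germs X F V s" if x: "x \<in> U" for x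
  proof -
    obtain V s where V: "openin X V" "x \<in> V" "s \<in> carrier (sections F V)"
      "\<And>y. y \<in> V \<inter> U \<Longrightarrow> \<sigma> y = germ F (nbhd_filter X y) V s"
      using r x by metis
    have VU: "openin X (V \<inter> U)" using V U by blast
    have "restrict \<sigma> (V \<inter> U) = germs X F (V \<inter> U) (restr F V (V \<inter> U) s)"
    proof
      fix y show "restrict \<sigma> (V \<inter> U) y = germs X F (V \<inter> U) (restr F V (V \<inter> U) s) y"
      proof (cases "y \<in> V \<inter> U")
        case True
        then interpret directed_colimit X F "nbhd_filter X y"
          using F U by (blast intro: stalk_colimit)
        show ?thesis using True V VU by (simp add: germs_def germ_restr mem_nbhd_filter)
      qed (auto simp: germs_def)
    qed
    then show ?thesis
      using V VU x presheaf_restr_closed[OF F V(1) VU] by blast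
  qed
  have "\<sigma> x \<in> carrier (stalk X F x)" if x: "x \<in> U" for x
  proof -
    interpret directed_colimit X F "nbhd_filter X x"
      using F U x by (blast intro: stalk_colimit)
    obtain V s where V: "openin X V" "x \<in> V" "s \<in> carrier (sections F V)"
      "\<And>y. y \<in> V \<inter> U \<Longrightarrow> \<sigma> y = germ F (nbhd_filter X y) V s"
      using r x by blast
    then show ?thesis using x by (simp add: germ_closed mem_nbhd_filter)
  qed
  then show ?l
    using r * by (auto simp: sheafify_def PiE_def)
qed

lemma sheafify_stalk:
  "\<sigma> \<in> carrier (sections (sheafify X F) U) \<Longrightarrow> x \<in> U \<Longrightarrow> \<sigma> x \<in> carrier (stalk X F x)"
  by (auto simp: sheafify_def)

lemma sheafify_mult:
  "\<sigma> \<otimes>\<^bsub>sections (sheafify X F) U\<^esub> \<tau> = (\<lambda>x\<in>U. \<sigma> x \<otimes>\<^bsub>stalk X F x\<^esub> \<tau> x)"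
  and sheafify_one: "\<one>\<^bsub>sections (sheafify X F) U\<^esub> = (\<lambda>x\<in>U. \<one>\<^bsub>stalk X F x\<^esub>)"
  and sheafify_restr: "restr (sheafify X F) U V \<sigma> = restrict \<sigma> V"
  by (simp_all add: sheafify_def)

lemma germs_closed:
  assumes "is_presheaf X F" "openin X U" "s \<in> carrier (sections F U)"
  shows "germs X F U s \<in> carrier (sections (sheafify X F) U)"
  using assms by (auto simp: sheafify_carrier_iff germs_def)

lemma germs_one:
  assumes "is_presheaf X F" "openin X U"
  shows "germs X F U \<one>\<^bsub>sections F U\<^esub> = \<one>\<^bsub>sections (sheafify X F) U\<^esub>"
  unfolding sheafify_one germs_def
proof (rule restrict_ext)
  fix x assume "x \<in> U"
  then interpret directed_colimit X F "nbhd_filter X x"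
    using assms by (blast intro: stalk_colimit)
  show "germ F (nbhd_filter X x) U \<one>\<^bsub>sections F U\<^esub> = \<one>\<^bsub>stalk X F x\<^esub>"
    using \<open>x \<in> U\<close> assms by (simp add: germ_one mem_nbhd_filter)
qed

lemma germs_mult:
  assumes "is_presheaf X F" "openin X U" "s \<in> carrier (sections F U)" "t \<in> carrier (sections F U)"
  shows "germs X F U (s \<otimes>\<^bsub>sections F U\<^esub> t) =
    germs X F U s \<otimes>\<^bsub>sections (sheafify X F) U\<^esub> germs X F U t"
  unfolding sheafify_mult germs_def
proof (rule restrict_ext)
  fix x assume "x \<in> U"
  then interpret directed_colimit X F "nbhd_filter X x"
    using assms by (blast intro: stalk_colimit)
  show "germ F (nbhd_filter X x) U (s \<otimes>\<^bsub>sections F U\<^esub> t) =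
    (\<lambda>x\<in>U. germ F (nbhd_filter X x) U s) x \<otimes>\<^bsub>stalk X F x\<^esub> (\<lambda>x\<in>U. germ F (nbhd_filter X x) U t) x"
    using \<open>x \<in> U\<close> assms by (simp add: germ_mult mem_nbhd_filter)
qed

lemma germs_restr:
  assumes "is_presheaf X F" "openin X U" "openin X V" "V \<subseteq> U" "s \<in> carrier (sections F U)"
  shows "germs X F V (restr F U V s) = restrict (germs X F U s) V"
proof
  fix x show "germs X F V (restr F U V s) x = restrict (germs X F U s) V x"
  proof (cases "x \<in> V")
    case True
    then interpret directed_colimit X F "nbhd_filter X x"
      using assms by (blast intro: stalk_colimit)
    show ?thesis using True assms by (auto simp: germs_def germ_restr mem_nbhd_filter)
  qed (simp add: germs_def)
qed

lemma sheafify_mult_closed: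
  assumes F: "is_presheaf X F" and U: "openin X U"
    and \<sigma>: "\<sigma> \<in> carrier (sections (sheafify X F) U)"
    and \<tau>: "\<tau> \<in> carrier (sections (sheafify X F) U)"
  shows "\<sigma> \<otimes>\<^bsub>sections (sheafify X F) U\<^esub> \<tau> \<in> carrier (sections (sheafify X F) U)"
  unfolding sheafify_carrier_iff[OF F U]
proof (intro conjI ballI)
  fix x assume x: "x \<in> U"
  obtain V s where V: "openin X V" "x \<in> V" "V \<subseteq> U" "s \<in> carrier (sections F V)"
    "\<forall>y\<in>V. \<sigma> y = germ F (nbhd_filter X y) V s"
    using \<sigma> x by (rule sheafify_carrierE)
  obtain V' t where V': "openin X V'" "x \<in> V'" "V' \<subseteq> U" "t \<in> carrier (sections F V')"
    "\<forall>y\<in>V'. \<tau> y = germ F (nbhd_filter X y) V' t"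
    using \<tau> x by (rule sheafify_carrierE)
  let ?W = "V \<inter> V'"
  let ?p = "restr F V ?W s \<otimes>\<^bsub>sections F ?W\<^esub> restr F V' ?W t"
  have W: "openin X ?W" using V V' by blast
  have "(\<sigma> \<otimes>\<^bsub>sections (sheafify X F) U\<^esub> \<tau>) y = germ F (nbhd_filter X y) ?W ?p"
    if "y \<in> ?W \<inter> U" for y
  proof -
    interpret directed_colimit X F "nbhd_filter X y"
      using F U that by (blast intro: stalk_colimit)
    show ?thesis
      using that V V' by (simp add: sheafify_mult germ_mult_Int mem_nbhd_filter)
  qed
  moreover have "?p \<in> carrier (sections F ?W)"
    using V V' W by (intro presheaf_mult_closed[OF F] presheaf_restr_closed[OF F]) auto
  ultimately show "\<exists>V s. openin X V \<and> x \<in> V \<and> s \<in> carrier (sections F V) \<and>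
       (\<forall>y\<in>V \<inter> U. (\<sigma> \<otimes>\<^bsub>sections (sheafify X F) U\<^esub> \<tau>) y = germ F (nbhd_filter X y) V s)"
    using W V V' by (intro exI[of _ ?W] exI[of _ ?p]) auto
qed (simp add: sheafify_mult)

text \<open>Taking germs is a group homomorphism, so where \<open>s\<close> represents the family,
  the inverse of \<open>s\<close> represents the pointwise inverse.\<close>

lemma sheafify_inv_closed:
  assumes F: "is_presheaf X F" and U: "openin X U"
    and \<sigma>: "\<sigma> \<in> carrier (sections (sheafify X F) U)"
  shows "(\<lambda>x\<in>U. inv\<^bsub>stalk X F x\<^esub> \<sigma> x) \<in> carrier (sections (sheafify X F) U)"
  unfolding sheafify_carrier_iff[OF F U]
proof (intro conjI ballI)
  fix x assume x: "x \<in> U"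
  obtain V s where V: "openin X V" "x \<in> V" "V \<subseteq> U" "s \<in> carrier (sections F V)"
    "\<forall>y\<in>V. \<sigma> y = germ F (nbhd_filter X y) V s"
    using \<sigma> x by (rule sheafify_carrierE)
  interpret S: comm_group "sections F V" using presheaf_group[OF F V(1)] .
  let ?p = "inv\<^bsub>sections F V\<^esub> s"
  have "(\<lambda>x\<in>U. inv\<^bsub>stalk X F x\<^esub> \<sigma> x) y = germ F (nbhd_filter X y) V ?p"
    if "y \<in> V \<inter> U" for y
  proof -
    interpret directed_colimit X F "nbhd_filter X y"
      using F U that by (blast intro: stalk_colimit)
    interpret C: comm_group "stalk X F y" by (rule colim_comm_group)
    interpret group_hom "sections F V" "stalk X F y" "germ F (nbhd_filter X y) V"
      using germ_hom[of V] that V by unfold_locales (simp add: mem_nbhd_filter)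
    show ?thesis using that V by simp
  qed
  then show "\<exists>V s. openin X V \<and> x \<in> V \<and> s \<in> carrier (sections F V) \<and>
       (\<forall>y\<in>V \<inter> U. (\<lambda>x\<in>U. inv\<^bsub>stalk X F x\<^esub> \<sigma> x) y = germ F (nbhd_filter X y) V s)"
    using V by (intro exI[of _ V] exI[of _ ?p]) auto
qed simp

text \<open>All group laws hold pointwise in the stalks. Sections are extensional functions, so
  pointwise identities on \<open>U\<close> are identities of sections.\<close>

lemma sheafify_comm_group:
  assumes F: "is_presheaf X F" and U: "openin X U"
  shows "comm_group (sections (sheafify X F) U)"
proof -
  have st: "comm_group (stalk X F x)" if "x \<in> U" for x
    using that by (rule directed_colimit.colim_comm_group[OF stalk_colimit[OF F U]])
  have ext: "\<sigma> \<in> extensional U" if "\<sigma> \<in> carrier (sections (sheafify X F) U)" for \<sigma>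
    using that by (simp add: sheafify_carrier_iff[OF F U])
  show ?thesis
  proof (rule comm_groupI)
    show "\<one>\<^bsub>sections (sheafify X F) U\<^esub> \<in> carrier (sections (sheafify X F) U)"
      using germs_one[OF F U] germs_closed[OF F U presheaf_one_closed[OF F U]] by simp
    fix \<sigma> assume \<sigma>: "\<sigma> \<in> carrier (sections (sheafify X F) U)"
    note \<sigma>' = sheafify_stalk[OF \<sigma>]
    show "\<one>\<^bsub>sections (sheafify X F) U\<^esub> \<otimes>\<^bsub>sections (sheafify X F) U\<^esub> \<sigma> = \<sigma>"
      unfolding sheafify_mult sheafify_one
      using st \<sigma>' ext[OF \<sigma>] by (intro extensionalityI[of _ U])
        (auto simp: comm_group_def comm_monoid_def monoid.l_one)
    show "\<exists>\<tau>\<in>carrier (sections (sheafify X F) U).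
        \<tau> \<otimes>\<^bsub>sections (sheafify X F) U\<^esub> \<sigma> = \<one>\<^bsub>sections (sheafify X F) U\<^esub>"
      using sheafify_inv_closed[OF F U \<sigma>] st \<sigma>'
      by (intro bexI[of _ "\<lambda>x\<in>U. inv\<^bsub>stalk X F x\<^esub> \<sigma> x"])
        (auto simp: sheafify_mult sheafify_one comm_group_def group.l_inv intro!: restrict_ext)
  next
    fix \<sigma> \<tau>
    assume \<sigma>: "\<sigma> \<in> carrier (sections (sheafify X F) U)"
      and \<tau>: "\<tau> \<in> carrier (sections (sheafify X F) U)"
    note \<sigma>' = sheafify_stalk[OF \<sigma>] and \<tau>' = sheafify_stalk[OF \<tau>]
    show "\<sigma> \<otimes>\<^bsub>sections (sheafify X F) U\<^esub> \<tau> \<in> carrier (sections (sheafify X F) U)"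
      using sheafify_mult_closed[OF F U \<sigma> \<tau>] .
    show "\<sigma> \<otimes>\<^bsub>sections (sheafify X F) U\<^esub> \<tau> = \<tau> \<otimes>\<^bsub>sections (sheafify X F) U\<^esub> \<sigma>"
      unfolding sheafify_mult using st \<sigma>' \<tau>'
      by (intro restrict_ext) (simp add: comm_group_def comm_monoid.m_comm)
    fix \<rho> assume \<rho>: "\<rho> \<in> carrier (sections (sheafify X F) U)"
    note \<rho>' = sheafify_stalk[OF \<rho>]
    show "\<sigma> \<otimes>\<^bsub>sections (sheafify X F) U\<^esub> \<tau> \<otimes>\<^bsub>sections (sheafify X F) U\<^esub> \<rho> =
      \<sigma> \<otimes>\<^bsub>sections (sheafify X F) U\<^esub> (\<tau> \<otimes>\<^bsub>sections (sheafify X F) U\<^esub> \<rho>)"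
      unfolding sheafify_mult using st \<sigma>' \<tau>' \<rho>'
      by (intro restrict_ext) (simp add: comm_group_def comm_monoid_def monoid.m_assoc)
  qed
qed

lemma sheafify_restr_closed:
  assumes F: "is_presheaf X F" and U: "openin X U" and V: "openin X V" "V \<subseteq> U"
    and \<sigma>: "\<sigma> \<in> carrier (sections (sheafify X F) U)"
  shows "restrict \<sigma> V \<in> carrier (sections (sheafify X F) V)"
  unfolding sheafify_carrier_iff[OF F V(1)]
proof (intro conjI ballI)
  fix x assume xV: "x \<in> V"
  then have x: "x \<in> U" using V by blast
  obtain V' s where "openin X V'" "x \<in> V'" "V' \<subseteq> U" "s \<in> carrier (sections F V')"
    "\<forall>y\<in>V'. \<sigma> y = germ F (nbhd_filter X y) V' s"
    using \<sigma> x by (rule sheafify_carrierE)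
  then show "\<exists>V' s. openin X V' \<and> x \<in> V' \<and> s \<in> carrier (sections F V') \<and>
       (\<forall>y\<in>V' \<inter> V. restrict \<sigma> V y = germ F (nbhd_filter X y) V' s)"
    using xV by (intro exI[of _ V'] exI[of _ s]) auto
qed simp

lemma sheafify_presheaf:
  assumes F: "is_presheaf X F"
  shows "is_presheaf X (sheafify X F)"
  unfolding is_presheaf_def
proof (intro conjI allI impI ballI; (elim conjE)?)
  fix U V assume U: "openin X U" and V: "openin X V" "V \<subseteq> U"
  show "restr (sheafify X F) U V \<in> hom (sections (sheafify X F) U) (sections (sheafify X F) V)"
  proof (rule homI)
    fix \<sigma> \<tau>
    assume "\<sigma> \<in> carrier (sections (sheafify X F) U)" "\<tau> \<in> carrier (sections (sheafify X F) U)"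
    show "restr (sheafify X F) U V (\<sigma> \<otimes>\<^bsub>sections (sheafify X F) U\<^esub> \<tau>) =
      restr (sheafify X F) U V \<sigma> \<otimes>\<^bsub>sections (sheafify X F) V\<^esub> restr (sheafify X F) U V \<tau>"
      using V by (auto simp: sheafify_mult sheafify_restr restrict_def fun_eq_iff)
  qed (simp add: sheafify_restr sheafify_restr_closed[OF F U V])
next
  fix U \<sigma> assume U: "openin X U" and "\<sigma> \<in> carrier (sections (sheafify X F) U)"
  then show "restr (sheafify X F) U U \<sigma> = \<sigma>"
    by (simp add: sheafify_restr sheafify_carrier_iff[OF F U] extensional_restrict)
next
  fix U V W :: "'a set" and \<sigma> assume "W \<subseteq> V"
  then show "restr (sheafify X F) V W (restr (sheafify X F) U V \<sigma>) = restr (sheafify X F) U W \<sigma>"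
    by (simp add: sheafify_restr inf.absorb2)
qed (use sheafify_comm_group[OF F] in blast)

section \<open>Isomorphisms of associated sheaves from matching local sections\<close>

text \<open>
  \<open>L\<close> is a family of pairs of local sections of \<open>A\<close> and \<open>B\<close> that matches their stalks. The
  axioms are symmetric in \<open>A\<close> and \<open>B\<close>, so the inverse isomorphism comes from \<open>swap\<close>.
\<close>

locale stalk_correspondence =
  fixes Y :: "'y topology" and A :: "('y, 'a) presheaf" and B :: "('y, 'b) presheaf"
    and L :: "'y set \<Rightarrow> 'a \<Rightarrow> 'b \<Rightarrow> bool"
  assumes presheaf_A: "is_presheaf Y A" and presheaf_B: "is_presheaf Y B"
    and L_sections: "L V a b \<Longrightarrow>
      openin Y V \<and> a \<in> carrier (sections A V) \<and> b \<in> carrier (sections B V)"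
    and left_total: "openin Y V \<Longrightarrow> y \<in> V \<Longrightarrow> a \<in> carrier (sections A V) \<Longrightarrow>
      \<exists>V' a' b'. L V' a' b' \<and> y \<in> V' \<and>
        germ A (nbhd_filter Y y) V a = germ A (nbhd_filter Y y) V' a'"
    and right_total: "openin Y V \<Longrightarrow> y \<in> V \<Longrightarrow> b \<in> carrier (sections B V) \<Longrightarrow>
      \<exists>V' a' b'. L V' a' b' \<and> y \<in> V' \<and>
        germ B (nbhd_filter Y y) V b = germ B (nbhd_filter Y y) V' b'"
    and germ_iff: "L V a b \<Longrightarrow> L V' a' b' \<Longrightarrow> y \<in> V \<Longrightarrow> y \<in> V' \<Longrightarrow>
      germ A (nbhd_filter Y y) V a = germ A (nbhd_filter Y y) V' a' \<longleftrightarrow>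
      germ B (nbhd_filter Y y) V b = germ B (nbhd_filter Y y) V' b'"
    and germ_mult: "L V a b \<Longrightarrow> L V' a' b' \<Longrightarrow> y \<in> V \<Longrightarrow> y \<in> V' \<Longrightarrow>
      \<exists>V'' a'' b''. L V'' a'' b'' \<and> y \<in> V'' \<and>
        germ A (nbhd_filter Y y) V'' a'' =
          germ A (nbhd_filter Y y) V a \<otimes>\<^bsub>stalk Y A y\<^esub> germ A (nbhd_filter Y y) V' a' \<and>
        germ B (nbhd_filter Y y) V'' b'' =
          germ B (nbhd_filter Y y) V b \<otimes>\<^bsub>stalk Y B y\<^esub> germ B (nbhd_filter Y y) V' b'"
begin

definition stalk_rel where
  "stalk_rel y \<alpha> \<beta> \<longleftrightarrow> (\<exists>V a b. L V a b \<and> y \<in> V \<and>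
     \<alpha> = germ A (nbhd_filter Y y) V a \<and> \<beta> = germ B (nbhd_filter Y y) V b)"

text \<open>\<open>stalk_rel_unique\<close> gives uniqueness, and \<open>stalk_rel_total\<close>
  gives existence at the values of sections of the associated sheaf. The \<open>THE\<close> is
  characterised only where a related element exists.\<close>

definition stalk_map where
  "stalk_map y \<alpha> = (THE \<beta>. stalk_rel y \<alpha> \<beta>)"

definition section_map where
  "section_map V \<sigma> = (\<lambda>y\<in>V. stalk_map y (\<sigma> y))"

lemma swap: "stalk_correspondence Y B A (\<lambda>V b a. L V a b)"
proof (unfold_locales, goal_cases)
  case (3 V b a) then show ?case using L_sections by simp
next
  case (4 V y b) then show ?case using right_total by metis
next
  case (5 V y a) then show ?case using left_total by metis
next
  case (6 V b a V' b' a' y) then show ?case using germ_iff by simp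
next
  case (7 V b a V' b' a' y) then show ?case using germ_mult[of V a b V' a' b' y] by metis
qed (fact presheaf_A presheaf_B)+

lemma stalk_relI:
  "L V a b \<Longrightarrow> y \<in> V \<Longrightarrow>
     stalk_rel y (germ A (nbhd_filter Y y) V a) (germ B (nbhd_filter Y y) V b)"
  unfolding stalk_rel_def by (intro exI conjI) simp_all

lemma stalk_relE:
  assumes "stalk_rel y \<alpha> \<beta>"
  obtains V a b where "L V a b" "y \<in> V"
    "\<alpha> = germ A (nbhd_filter Y y) V a" "\<beta> = germ B (nbhd_filter Y y) V b"
  using assms unfolding stalk_rel_def by (elim exE conjE)

text \<open>This is the implication of \<open>germ_iff\<close> from germs of \<open>A\<close> to
  germs of \<open>B\<close>. The converse implication enters through the swapped correspondence and
  makes the map on stalks injective.\<close>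

lemma stalk_rel_unique:
  assumes "stalk_rel y \<alpha> \<beta>" "stalk_rel y \<alpha> \<beta>'"
  shows "\<beta> = \<beta>'"
  using assms(1)
proof (rule stalk_relE)
  fix V a b
  assume *: "L V a b" "y \<in> V"
    "\<alpha> = germ A (nbhd_filter Y y) V a" "\<beta> = germ B (nbhd_filter Y y) V b"
  show ?thesis
    using assms(2)
  proof (rule stalk_relE)
    fix V' a' b'
    assume "L V' a' b'" "y \<in> V'"
      "\<alpha> = germ A (nbhd_filter Y y) V' a'" "\<beta>' = germ B (nbhd_filter Y y) V' b'"
    then show ?thesis using * germ_iff[of V a b V' a' b' y] by simp
  qed
qed

lemma stalk_map_eq: "stalk_rel y \<alpha> \<beta> \<Longrightarrow> stalk_map y \<alpha> = \<beta>"
  unfolding stalk_map_def by (rule the_equality, assumption) (rule stalk_rel_unique)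

lemma stalk_rel_total:
  assumes "\<sigma> \<in> carrier (sections (sheafify Y A) V)" "y \<in> V"
  shows "\<exists>\<beta>. stalk_rel y (\<sigma> y) \<beta>"
proof -
  obtain V' a where V': "openin Y V'" "y \<in> V'" "V' \<subseteq> V" "a \<in> carrier (sections A V')"
    "\<forall>y\<in>V'. \<sigma> y = germ A (nbhd_filter Y y) V' a"
    using assms by (rule sheafify_carrierE)
  obtain V1 a1 b1 where "L V1 a1 b1" "y \<in> V1"
    "germ A (nbhd_filter Y y) V' a = germ A (nbhd_filter Y y) V1 a1"
    using left_total[OF V'(1,2,4)] by (elim exE conjE)
  then show ?thesis using V'(2,5) stalk_relI[of V1 a1 b1 y] by auto
qed

lemma stalk_rel_map:
  assumes "\<sigma> \<in> carrier (sections (sheafify Y A) V)" "y \<in> V"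
  shows "stalk_rel y (\<sigma> y) (stalk_map y (\<sigma> y))"
  using stalk_rel_total[OF assms] by (auto simp: stalk_map_eq)

lemma stalk_rel_mult:
  assumes "stalk_rel y \<alpha> \<beta>" "stalk_rel y \<alpha>' \<beta>'"
  shows "stalk_rel y (\<alpha> \<otimes>\<^bsub>stalk Y A y\<^esub> \<alpha>') (\<beta> \<otimes>\<^bsub>stalk Y B y\<^esub> \<beta>')"
  using assms(1)
proof (rule stalk_relE)
  fix V a b
  assume *: "L V a b" "y \<in> V"
    "\<alpha> = germ A (nbhd_filter Y y) V a" "\<beta> = germ B (nbhd_filter Y y) V b"
  show ?thesis
    using assms(2)
  proof (rule stalk_relE)
    fix V' a' b'
    assume **: "L V' a' b'" "y \<in> V'"
      "\<alpha>' = germ A (nbhd_filter Y y) V' a'" "\<beta>' = germ B (nbhd_filter Y y) V' b'"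
    obtain V'' a'' b'' where "L V'' a'' b''" "y \<in> V''"
      "germ A (nbhd_filter Y y) V'' a'' = \<alpha> \<otimes>\<^bsub>stalk Y A y\<^esub> \<alpha>'"
      "germ B (nbhd_filter Y y) V'' b'' = \<beta> \<otimes>\<^bsub>stalk Y B y\<^esub> \<beta>'"
      using germ_mult[OF *(1) **(1) *(2) **(2)] unfolding *(3,4) **(3,4) by (elim exE conjE)
    then show ?thesis using stalk_relI[of V'' a'' b'' y] by simp
  qed
qed

text \<open>The stalk map is defined point by point, so the issue is that its values near
  \<open>y\<close> come from one section of \<open>B\<close>. A single related pair
  \<open>(a1, b1)\<close> computes the values at all points of a neighbourhood of
  \<open>y\<close>.\<close>

lemma section_map_closed:
  assumes V: "openin Y V" and \<sigma>: "\<sigma> \<in> carrier (sections (sheafify Y A) V)"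
  shows "section_map V \<sigma> \<in> carrier (sections (sheafify Y B) V)"
  unfolding sheafify_carrier_iff[OF presheaf_B V]
proof (intro conjI ballI)
  fix y assume y: "y \<in> V"
  obtain V' a where V': "openin Y V'" "y \<in> V'" "V' \<subseteq> V" "a \<in> carrier (sections A V')"
    "\<forall>z\<in>V'. \<sigma> z = germ A (nbhd_filter Y z) V' a"
    using \<sigma> y by (rule sheafify_carrierE)
  obtain V1 a1 b1 where L: "L V1 a1 b1" "y \<in> V1"
    "germ A (nbhd_filter Y y) V' a = germ A (nbhd_filter Y y) V1 a1"
    using left_total[OF V'(1,2,4)] by (elim exE conjE)
  have V1: "openin Y V1" "a1 \<in> carrier (sections A V1)" "b1 \<in> carrier (sections B V1)"
    using L_sections[OF L(1)] by simp_all
  \<comment> \<open>Equality of the germs of \<open>a\<close> and \<open>a1\<close> at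
    \<open>y\<close> is witnessed by equal restrictions on an open \<open>W\<close>, hence the germs
    agree at every point of \<open>W\<close>, and there \<open>b1\<close> gives the image.\<close>
  have "\<exists>W\<in>nbhd_filter Y y. W \<subseteq> V' \<inter> V1 \<and> restr A V' W a = restr A V1 W a1"
    using directed_colimit.germ_eq_iff[OF stalk_colimit[OF presheaf_A V y]] L V1 V'
    by (simp add: mem_nbhd_filter)
  then obtain W where W: "openin Y W" "y \<in> W" "W \<subseteq> V'" "W \<subseteq> V1" "restr A V' W a = restr A V1 W a1"
    by (auto simp: mem_nbhd_filter)
  have "section_map V \<sigma> z = germ B (nbhd_filter Y z) W (restr B V1 W b1)" if z: "z \<in> W" for z
  proof -
    interpret B: directed_colimit Y B "nbhd_filter Y z"
      using presheaf_B W(1) z by (rule stalk_colimit)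
    interpret A: directed_colimit Y A "nbhd_filter Y z"
      using presheaf_A W(1) z by (rule stalk_colimit)
    have "germ A (nbhd_filter Y z) V' a = germ A (nbhd_filter Y z) V1 a1"
      using V' V1 W z by (intro A.germ_eqI[where W = W]) (auto simp: mem_nbhd_filter)
    then have "stalk_rel z (\<sigma> z) (germ B (nbhd_filter Y z) V1 b1)"
      using stalk_relI[OF L(1), of z] V' W z by (simp add: subset_iff)
    moreover have "germ B (nbhd_filter Y z) W (restr B V1 W b1) = germ B (nbhd_filter Y z) V1 b1"
      using V1 W z by (intro B.germ_restr) (auto simp: mem_nbhd_filter)
    ultimately show ?thesis
      using z W V' by (simp add: section_map_def stalk_map_eq subset_iff)
  qed
  then show "\<exists>V' s. openin Y V' \<and> y \<in> V' \<and> s \<in> carrier (sections B V') \<and>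
      (\<forall>z\<in>V' \<inter> V. section_map V \<sigma> z = germ B (nbhd_filter Y z) V' s)"
    using W presheaf_restr_closed[OF presheaf_B V1(1) W(1,4) V1(3)]
    by (intro exI[of _ W] exI[of _ "restr B V1 W b1"]) simp
qed (simp add: section_map_def)

interpretation sw: stalk_correspondence Y B A "\<lambda>V b a. L V a b"
  by (rule swap)

lemma stalk_rel_swap: "stalk_rel y \<alpha> \<beta> \<Longrightarrow> sw.stalk_rel y \<beta> \<alpha>"
  by (erule stalk_relE) (simp add: sw.stalk_relI)

lemma section_map_swap:
  assumes V: "openin Y V" and \<sigma>: "\<sigma> \<in> carrier (sections (sheafify Y A) V)"
  shows "sw.section_map V (section_map V \<sigma>) = \<sigma>"
proof -
  have "sw.stalk_map y (stalk_map y (\<sigma> y)) = \<sigma> y" if "y \<in> V" for y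
    using stalk_rel_map[OF \<sigma> that] by (rule sw.stalk_map_eq[OF stalk_rel_swap])
  moreover have "\<sigma> \<in> extensional V"
    using \<sigma> by (simp add: sheafify_carrier_iff[OF presheaf_A V])
  ultimately show ?thesis
    by (intro extensionalityI[of _ V]) (simp_all add: section_map_def sw.section_map_def)
qed

lemma section_map_iso:
  "sheaf_iso Y (sheafify Y A) (sheafify Y B) section_map"
proof -
  have hom: "section_map V \<in> hom (sections (sheafify Y A) V) (sections (sheafify Y B) V)"
    if V: "openin Y V" for V
  proof (rule homI)
    fix \<sigma> \<tau>
    assume \<sigma>: "\<sigma> \<in> carrier (sections (sheafify Y A) V)"
      and \<tau>: "\<tau> \<in> carrier (sections (sheafify Y A) V)"
    show "section_map V (\<sigma> \<otimes>\<^bsub>sections (sheafify Y A) V\<^esub> \<tau>) =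
      section_map V \<sigma> \<otimes>\<^bsub>sections (sheafify Y B) V\<^esub> section_map V \<tau>"
      using stalk_map_eq[OF stalk_rel_mult[OF stalk_rel_map[OF \<sigma>] stalk_rel_map[OF \<tau>]]]
      by (simp add: section_map_def sheafify_mult cong: restrict_cong)
  qed (rule section_map_closed[OF V])
  have "bij_betw (section_map V) (carrier (sections (sheafify Y A) V))
      (carrier (sections (sheafify Y B) V))" if V: "openin Y V" for V
    by (rule bij_betw_byWitness[where f' = "sw.section_map V"])
      (use section_map_swap[OF V] section_map_closed[OF V] sw.section_map_closed[OF V]
        stalk_correspondence.section_map_swap[OF swap V] in \<open>auto\<close>)
  moreover have "section_map V (restr (sheafify Y A) U V \<sigma>) =
      restr (sheafify Y B) U V (section_map U \<sigma>)" if "V \<subseteq> U" for U V \<sigma>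
    using that by (auto simp: sheafify_restr section_map_def fun_eq_iff)
  ultimately show ?thesis
    using hom by (simp add: sheaf_iso_def sheaf_hom_def iso_def)
qed

text \<open>This is what later identifies the isomorphism with the canonical morphism, since it
  prescribes the values on sections coming from the two presheaves.\<close>

lemma section_map_germs:
  assumes "L V a b"
  shows "section_map V (germs Y A V a) = germs Y B V b"
proof -
  have "stalk_rel y (germ A (nbhd_filter Y y) V a) (germ B (nbhd_filter Y y) V b)" if "y \<in> V" for y
    using assms that by (rule stalk_relI)
  then show ?thesis
    by (auto simp: section_map_def germs_def stalk_map_eq fun_eq_iff)
qed

end

section \<open>Inverse images\<close>

lemma nbhds_of_image_colimit:
  assumes "is_presheaf Z S" "f ` V \<subseteq> topspace Z"
  shows "directed_colimit Z S (nbhds_of_image Z f V)"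
proof
  have "topspace Z \<in> nbhds_of_image Z f V" using assms(2) by (simp add: nbhds_of_image_def)
  then show "nbhds_of_image Z f V \<noteq> {}" by blast
qed (simp_all add: assms(1) nbhds_of_image_def openin_Int)

lemma inverse_image_presheaf_sections:
  "sections (inverse_image_presheaf Z f S) V = colim S (nbhds_of_image Z f V)"
  by (simp add: inverse_image_presheaf_def)

text \<open>A neighbourhood of \<open>f\<close> V\<open>is also one of\<close>f \<open>V'\<close>.
  Hence a witness \<open>R\<close> that two representatives agree over \<open>V\<close> still serves
  over \<open>V'\<close>, and the union in the definition of the restriction is over equal
  classes.\<close>

lemma inverse_image_presheaf_restr_germ:
  assumes S: "is_presheaf Z S" and V: "f ` V \<subseteq> topspace Z" "V' \<subseteq> V"
    and W: "W \<in> nbhds_of_image Z f V" "s \<in> carrier (sections S W)"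
  shows "restr (inverse_image_presheaf Z f S) V V' (germ S (nbhds_of_image Z f V) W s) =
    germ S (nbhds_of_image Z f V') W s"
proof -
  have sub: "T \<in> nbhds_of_image Z f V'" if "T \<in> nbhds_of_image Z f V" for T
    using V(2) that by (auto simp: nbhds_of_image_def)
  interpret V: directed_colimit Z S "nbhds_of_image Z f V"
    using S V(1) by (rule nbhds_of_image_colimit)
  interpret V': directed_colimit Z S "nbhds_of_image Z f V'"
    using V by (intro nbhds_of_image_colimit[OF S]) auto
  show ?thesis
    unfolding inverse_image_presheaf_def presheaf.simps
  proof (rule V.Union_germ_const[OF W])
    fix T t
    assume T: "T \<in> nbhds_of_image Z f V" "t \<in> carrier (sections S T)"
      and eq: "germ S (nbhds_of_image Z f V) T t = germ S (nbhds_of_image Z f V) W s"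
    obtain R where "R \<in> nbhds_of_image Z f V" "R \<subseteq> T \<inter> W" "restr S T R t = restr S W R s"
      using eq V.germ_eq_iff[OF T W] by auto
    then show "germ S (nbhds_of_image Z f V') T t = germ S (nbhds_of_image Z f V') W s"
      using T W sub by (intro V'.germ_eqI[where W = R]) auto
  qed
qed

lemma inverse_image_presheaf_is_presheaf:
  assumes S: "is_presheaf Z S" and f: "f ` topspace Y \<subseteq> topspace Z"
  shows "is_presheaf Y (inverse_image_presheaf Z f S)"
proof -
  let ?N = "nbhds_of_image Z f" and ?I = "inverse_image_presheaf Z f S"
  have top: "f ` V \<subseteq> topspace Z" if "openin Y V" for V
    using openin_subset[OF that] f by auto
  have sub: "W \<in> ?N V'" if "W \<in> ?N V" "V' \<subseteq> V" for W V V'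
    using that by (auto simp: nbhds_of_image_def)
  have colim: "directed_colimit Z S (?N V)" if "openin Y V" for V
    using S top[OF that] by (rule nbhds_of_image_colimit)
  show ?thesis
    unfolding is_presheaf_def
  proof (intro conjI allI impI ballI; (elim conjE)?)
    fix U assume U: "openin Y U"
    show "comm_group (sections ?I U)"
      unfolding inverse_image_presheaf_sections
      by (rule directed_colimit.colim_comm_group[OF colim[OF U]])
    fix a assume a: "a \<in> carrier (sections ?I U)"
    obtain W s where W: "W \<in> ?N U" "s \<in> carrier (sections S W)" "a = germ S (?N U) W s"
      using a unfolding inverse_image_presheaf_sections
      by (rule directed_colimit.colimE[OF colim[OF U]])
    then show "restr ?I U U a = a"
      using inverse_image_presheaf_restr_germ[OF S top[OF U] subset_refl] by simp
  next
    fix U V assume U: "openin Y U" and V: "openin Y V" "V \<subseteq> U"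
    interpret U: directed_colimit Z S "?N U" by (rule colim[OF U])
    interpret V: directed_colimit Z S "?N V" by (rule colim[OF V(1)])
    note restr = inverse_image_presheaf_restr_germ[OF S top[OF U] V(2)]
    show "restr ?I U V \<in> hom (sections ?I U) (sections ?I V)"
      unfolding inverse_image_presheaf_sections
    proof (rule homI)
      fix a assume "a \<in> carrier (colim S (?N U))"
      then obtain W s where W: "W \<in> ?N U" "s \<in> carrier (sections S W)" "a = germ S (?N U) W s"
        by (rule U.colimE)
      show "restr ?I U V a \<in> carrier (colim S (?N V))"
        unfolding W(3) restr[OF W(1,2)] using sub[OF W(1) V(2)] W(2) by (rule V.germ_closed)
    next
      fix a b assume "a \<in> carrier (colim S (?N U))" "b \<in> carrier (colim S (?N U))"
      then obtain W s t where W: "W \<in> ?N U" "s \<in> carrier (sections S W)"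
        "t \<in> carrier (sections S W)" "a = germ S (?N U) W s" "b = germ S (?N U) W t"
        by (rule U.colim_common_rep)
      have st: "s \<otimes>\<^bsub>sections S W\<^esub> t \<in> carrier (sections S W)"
        using presheaf_mult_closed[OF S U.opens[OF W(1)] W(2,3)] .
      show "restr ?I U V (a \<otimes>\<^bsub>colim S (?N U)\<^esub> b) =
        restr ?I U V a \<otimes>\<^bsub>colim S (?N V)\<^esub> restr ?I U V b"
        unfolding W(4,5) U.germ_mult[OF W(1-3), symmetric]
          restr[OF W(1,2)] restr[OF W(1,3)] restr[OF W(1) st]
        using sub[OF W(1) V(2)] W(2,3) by (rule V.germ_mult)
    qed
  next
    fix U V T a
    assume U: "openin Y U" and V: "openin Y V" and T: "openin Y T" and TV: "T \<subseteq> V" and VU: "V \<subseteq> U"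
      and a: "a \<in> carrier (sections ?I U)"
    obtain W s where W: "W \<in> ?N U" "s \<in> carrier (sections S W)" "a = germ S (?N U) W s"
      using a unfolding inverse_image_presheaf_sections
      by (rule directed_colimit.colimE[OF colim[OF U]])
    show "restr ?I V T (restr ?I U V a) = restr ?I U T a"
      unfolding W(3) inverse_image_presheaf_restr_germ[OF S top[OF U] VU W(1,2)]
        inverse_image_presheaf_restr_germ[OF S top[OF V] TV sub[OF W(1) VU] W(2)]
        inverse_image_presheaf_restr_germ[OF S top[OF U] subset_trans[OF TV VU] W(1,2)] ..
  qed
qed

text \<open>The morphism \<open>r\<close> is adjoint to one from the inverse image of
  \<open>P\<close> to \<open>Q\<close>. The last two axioms say that the induced map from the stalk
  of \<open>P\<close> at \<open>f y\<close> to the stalk of \<open>Q\<close> at \<open>y\<close> has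
  trivial kernel and is onto. They are stated with representatives, which avoids constructing that
  map.\<close>

locale stalkwise_iso =
  fixes Y :: "'y topology" and Z :: "'z topology" and f :: "'y \<Rightarrow> 'z"
    and P :: "('z, 'p) presheaf" and Q :: "('y, 'q) presheaf" and r :: "'z set \<Rightarrow> 'p \<Rightarrow> 'q"
  assumes continuous: "continuous_map Y Z f"
    and presheaf_P: "is_presheaf Z P" and presheaf_Q: "is_presheaf Y Q"
    and r_hom: "sheaf_hom Z P (direct_image Y f Q) r"
    and stalk_inj: "openin Z W \<Longrightarrow> y \<in> topspace Y \<Longrightarrow> f y \<in> W \<Longrightarrow> s \<in> carrier (sections P W) \<Longrightarrow>
      openin Y V \<Longrightarrow> y \<in> V \<Longrightarrow> V \<subseteq> preimage Y f W \<Longrightarrow>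
      restr Q (preimage Y f W) V (r W s) = \<one>\<^bsub>sections Q V\<^esub> \<Longrightarrow>
      \<exists>W'. openin Z W' \<and> f y \<in> W' \<and> W' \<subseteq> W \<and> restr P W W' s = \<one>\<^bsub>sections P W'\<^esub>"
    and stalk_surj: "openin Y V \<Longrightarrow> y \<in> V \<Longrightarrow> q \<in> carrier (sections Q V) \<Longrightarrow>
      \<exists>W s V'. openin Z W \<and> f y \<in> W \<and> s \<in> carrier (sections P W) \<and>
        openin Y V' \<and> y \<in> V' \<and> V' \<subseteq> V \<and> V' \<subseteq> preimage Y f W \<and>
        restr Q V V' q = restr Q (preimage Y f W) V' (r W s)"
begin

section \<open>Germs of the inverse image that come from sections of \<open>P\<close>\<close>

abbreviation "S \<equiv> sheafify Z P"
abbreviation "IP \<equiv> inverse_image_presheaf Z f S"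
abbreviation "pre W \<equiv> preimage Y f W"

text \<open>The image of a section of \<open>P\<close> in the inverse image presheaf: first into the
  associated sheaf, then into the direct limit over neighbourhoods of the image of
  \<open>pre W\<close>. Taking \<open>germs\<close> of the result gives the adjunction unit applied
  to \<open>germs Z P W s\<close>.\<close>

definition pull where
  "pull W s = germ S (nbhds_of_image Z f (pre W)) W (germs Z P W s)"

lemma presheaf_S: "is_presheaf Z S"
  using presheaf_P by (rule sheafify_presheaf)

lemma image_topspace: "f ` topspace Y \<subseteq> topspace Z"
  using continuous by (rule continuous_map_image_subset_topspace)

lemma presheaf_IP: "is_presheaf Y IP"
  using presheaf_S image_topspace by (rule inverse_image_presheaf_is_presheaf)

lemma open_pre: "openin Z W \<Longrightarrow> openin Y (pre W)"
  using continuous by (rule openin_preimage)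

lemma mem_pre: "y \<in> topspace Y \<Longrightarrow> y \<in> pre W \<longleftrightarrow> f y \<in> W"
  by (simp add: preimage_def)

lemma mem_preD: "y \<in> pre W \<Longrightarrow> y \<in> topspace Y \<and> f y \<in> W"
  by (simp add: preimage_def)

lemma image_open: "openin Y V \<Longrightarrow> f ` V \<subseteq> topspace Z"
  using image_topspace openin_subset by fastforce

lemma nbhds_of_image_pre: "openin Z W \<Longrightarrow> V \<subseteq> pre W \<Longrightarrow> W \<in> nbhds_of_image Z f V"
  by (auto simp: nbhds_of_image_def preimage_def)

lemma r_in_hom: "openin Z W \<Longrightarrow> r W \<in> hom (sections P W) (sections Q (pre W))"
  using r_hom by (simp add: sheaf_hom_def direct_image_def)

lemma r_closed: "openin Z W \<Longrightarrow> s \<in> carrier (sections P W) \<Longrightarrow> r W s \<in> carrier (sections Q (pre W))"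
  using r_in_hom by (rule hom_in_carrier)

lemma r_restr:
  "openin Z W \<Longrightarrow> openin Z W' \<Longrightarrow> W' \<subseteq> W \<Longrightarrow> s \<in> carrier (sections P W) \<Longrightarrow>
     r W' (restr P W W' s) = restr Q (pre W) (pre W') (r W s)"
  using r_hom by (simp add: sheaf_hom_def direct_image_def)

lemma pull_closed:
  assumes "openin Z W" "s \<in> carrier (sections P W)"
  shows "pull W s \<in> carrier (sections IP (pre W))"
  unfolding pull_def inverse_image_presheaf_sections
  using directed_colimit.germ_closed[OF nbhds_of_image_colimit[OF presheaf_S image_open[OF open_pre[OF assms(1)]]]]
    nbhds_of_image_pre[OF assms(1) subset_refl] germs_closed[OF presheaf_P assms] .

lemma pull_restr:
  assumes W: "openin Z W" "s \<in> carrier (sections P W)" and V: "V \<subseteq> pre W"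
  shows "restr IP (pre W) V (pull W s) = germ S (nbhds_of_image Z f V) W (germs Z P W s)"
  unfolding pull_def
  by (rule inverse_image_presheaf_restr_germ[OF presheaf_S image_open[OF open_pre[OF W(1)]] V
    nbhds_of_image_pre[OF W(1) subset_refl] germs_closed[OF presheaf_P W]])

lemma pull_mult:
  assumes W: "openin Z W" "s \<in> carrier (sections P W)" "t \<in> carrier (sections P W)"
  shows "pull W (s \<otimes>\<^bsub>sections P W\<^esub> t) = pull W s \<otimes>\<^bsub>sections IP (pre W)\<^esub> pull W t"
  unfolding pull_def inverse_image_presheaf_sections germs_mult[OF presheaf_P W]
  by (rule directed_colimit.germ_mult[OF nbhds_of_image_colimit[OF presheaf_S image_open[OF open_pre[OF W(1)]]]
    nbhds_of_image_pre[OF W(1) subset_refl] germs_closed[OF presheaf_P W(1,2)] germs_closed[OF presheaf_P W(1,3)]])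

text \<open>
  The right-hand side, shared with \<open>r_germ_eq_iff\<close>, is equality of germs in the stalk of \<open>P\<close> at
  \<open>f y\<close>; hence the stalks of \<open>IP\<close> and of \<open>Q\<close> at \<open>y\<close> agree.
\<close>

lemma pull_germ_eq_iff:
  assumes W: "openin Z W" "s \<in> carrier (sections P W)"
    and W': "openin Z W'" "s' \<in> carrier (sections P W')"
    and y: "y \<in> pre W" "y \<in> pre W'"
  shows "germ IP (nbhd_filter Y y) (pre W) (pull W s) = germ IP (nbhd_filter Y y) (pre W') (pull W' s') \<longleftrightarrow>
    (\<exists>R. openin Z R \<and> f y \<in> R \<and> R \<subseteq> W \<and> R \<subseteq> W' \<and> restr P W R s = restr P W' R s')"
proof -
  interpret IP: directed_colimit Y IP "nbhd_filter Y y"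
    by (rule stalk_colimit[OF presheaf_IP open_pre[OF W(1)] y(1)])
  have pre: "pre W \<in> nbhd_filter Y y" "pre W' \<in> nbhd_filter Y y"
    using open_pre W W' y by (simp_all add: mem_nbhd_filter)
  have fy: "f y \<in> W" "f y \<in> W'" "y \<in> topspace Y" using y mem_preD by blast+
  interpret P: directed_colimit Z P "nbhd_filter Z (f y)"
    by (rule stalk_colimit[OF presheaf_P W(1) fy(1)])
  show ?thesis
  proof
    assume "germ IP (nbhd_filter Y y) (pre W) (pull W s) = germ IP (nbhd_filter Y y) (pre W') (pull W' s')"
    then obtain V where V: "openin Y V" "y \<in> V" "V \<subseteq> pre W" "V \<subseteq> pre W'"
      "restr IP (pre W) V (pull W s) = restr IP (pre W') V (pull W' s')"
      using IP.germ_eq_iff[OF pre(1) pull_closed[OF W] pre(2) pull_closed[OF W']]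
      by (auto simp: mem_nbhd_filter)
    interpret V: directed_colimit Z S "nbhds_of_image Z f V"
      by (rule nbhds_of_image_colimit[OF presheaf_S image_open[OF V(1)]])
    have "germ S (nbhds_of_image Z f V) W (germs Z P W s) =
      germ S (nbhds_of_image Z f V) W' (germs Z P W' s')"
      using V(5) unfolding pull_restr[OF W V(3)] pull_restr[OF W' V(4)] .
    then obtain T where T: "T \<in> nbhds_of_image Z f V" "T \<subseteq> W \<inter> W'"
      "restrict (germs Z P W s) T = restrict (germs Z P W' s') T"
      using V.germ_eq_iff[OF nbhds_of_image_pre[OF W(1) V(3)] germs_closed[OF presheaf_P W]
          nbhds_of_image_pre[OF W'(1) V(4)] germs_closed[OF presheaf_P W']]
      by (auto simp: sheafify_restr)
    \<comment> \<open>Equal sections of the associated sheaf over \<open>T\<close> are equal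
      families of germs. Evaluating at the point \<open>f y\<close>, which lies in \<open>T\<close>
      because \<open>y\<close> lies in \<open>V\<close>, returns to germs of
      \<open>P\<close>.\<close>
    have "f y \<in> T" using T(1) V(2) by (auto simp: nbhds_of_image_def)
    then have "germ P (nbhd_filter Z (f y)) W s = germ P (nbhd_filter Z (f y)) W' s'"
      using fun_cong[OF T(3), of "f y"] fy by (simp add: germs_apply)
    then show "\<exists>R. openin Z R \<and> f y \<in> R \<and> R \<subseteq> W \<and> R \<subseteq> W' \<and> restr P W R s = restr P W' R s'"
      using P.germ_eq_iff[OF _ W(2) _ W'(2)] W(1) W'(1) fy by (auto simp: mem_nbhd_filter)
  next
    assume "\<exists>R. openin Z R \<and> f y \<in> R \<and> R \<subseteq> W \<and> R \<subseteq> W' \<and> restr P W R s = restr P W' R s'"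
    then obtain R where R: "openin Z R" "f y \<in> R" "R \<subseteq> W" "R \<subseteq> W'" "restr P W R s = restr P W' R s'"
      by auto
    interpret R: directed_colimit Z S "nbhds_of_image Z f (pre R)"
      by (rule nbhds_of_image_colimit[OF presheaf_S image_open[OF open_pre[OF R(1)]]])
    have "germ S (nbhds_of_image Z f (pre R)) W (germs Z P W s) =
      germ S (nbhds_of_image Z f (pre R)) W' (germs Z P W' s')"
    proof (rule R.germ_eqI[where W = R])
      show "restr S W R (germs Z P W s) = restr S W' R (germs Z P W' s')"
        unfolding sheafify_restr germs_restr[OF presheaf_P W(1) R(1,3) W(2), symmetric]
          germs_restr[OF presheaf_P W'(1) R(1,4) W'(2), symmetric] R(5) ..
    qed (use W W' R in \<open>simp_all add: germs_closed[OF presheaf_P] nbhds_of_image_pre preimage_mono\<close>)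
    then have "restr IP (pre W) (pre R) (pull W s) = restr IP (pre W') (pre R) (pull W' s')"
      unfolding pull_restr[OF W preimage_mono[OF R(3)]] pull_restr[OF W' preimage_mono[OF R(4)]] .
    moreover have "pre R \<in> nbhd_filter Y y"
      using open_pre[OF R(1)] R(2) fy(3) by (simp add: mem_nbhd_filter mem_pre)
    ultimately show "germ IP (nbhd_filter Y y) (pre W) (pull W s) =
      germ IP (nbhd_filter Y y) (pre W') (pull W' s')"
      by (intro IP.germ_eqI[where W = "pre R"] pre pull_closed W W' preimage_mono R)
  qed
qed

text \<open>The forward direction is injectivity on stalks. As \<open>stalk_inj\<close> treats only
  sections whose image becomes trivial, both sections are restricted to \<open>W \<inter> W'\<close>
  and it is applied to the quotient of the two; the result is then turned back into an equality. The
  backward direction is compatibility of \<open>r\<close> with restriction.\<close>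

lemma r_germ_eq_iff:
  assumes W: "openin Z W" "s \<in> carrier (sections P W)"
    and W': "openin Z W'" "s' \<in> carrier (sections P W')"
    and y: "y \<in> pre W" "y \<in> pre W'"
  shows "germ Q (nbhd_filter Y y) (pre W) (r W s) = germ Q (nbhd_filter Y y) (pre W') (r W' s') \<longleftrightarrow>
    (\<exists>R. openin Z R \<and> f y \<in> R \<and> R \<subseteq> W \<and> R \<subseteq> W' \<and> restr P W R s = restr P W' R s')"
proof -
  interpret Q: directed_colimit Y Q "nbhd_filter Y y"
    by (rule stalk_colimit[OF presheaf_Q open_pre[OF W(1)] y(1)])
  have pre: "pre W \<in> nbhd_filter Y y" "pre W' \<in> nbhd_filter Y y"
    using open_pre W W' y by (simp_all add: mem_nbhd_filter)
  have fy: "f y \<in> W" "f y \<in> W'" "y \<in> topspace Y" using y mem_preD by blast+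
  show ?thesis
  proof
    assume "germ Q (nbhd_filter Y y) (pre W) (r W s) = germ Q (nbhd_filter Y y) (pre W') (r W' s')"
    then obtain V where V: "openin Y V" "y \<in> V" "V \<subseteq> pre W" "V \<subseteq> pre W'"
      "restr Q (pre W) V (r W s) = restr Q (pre W') V (r W' s')"
      using Q.germ_eq_iff[OF pre(1) r_closed[OF W] pre(2) r_closed[OF W']]
      by (auto simp: mem_nbhd_filter)
    let ?W = "W \<inter> W'"
    have o: "openin Z ?W" "openin Y (pre ?W)" using W W' by (simp_all add: open_pre openin_Int)
    have VW: "V \<subseteq> pre ?W" using V by (auto simp: preimage_def)
    let ?s = "restr P W ?W s" and ?s' = "restr P W' ?W s'"
    have cl: "?s \<in> carrier (sections P ?W)" "?s' \<in> carrier (sections P ?W)"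
      using W W' o by (simp_all add: presheaf_restr_closed[OF presheaf_P])
    interpret GW: comm_group "sections P ?W" using presheaf_P o(1) by (rule presheaf_group)
    interpret GV: comm_group "sections Q V" using presheaf_Q V(1) by (rule presheaf_group)
    let ?h = "\<lambda>u. restr Q (pre ?W) V (r ?W u)"
    have h: "?h \<in> hom (sections P ?W) (sections Q V)"
      using hom_compose[OF r_in_hom[OF o(1)] presheaf_hom[OF presheaf_Q o(2) V(1) VW]]
      by (simp add: comp_def)
    interpret h: group_hom "sections P ?W" "sections Q V" ?h
      using h by unfold_locales
    have "?h ?s = restr Q (pre W) V (r W s)" "?h ?s' = restr Q (pre W') V (r W' s')"
      using W W' o V VW preimage_mono[of ?W W Y f] preimage_mono[of ?W W' Y f]
      by (simp_all add: r_restr presheaf_restr_restr[OF presheaf_Q] open_pre r_closed)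
    then have "?h ?s = ?h ?s'" using V(5) by simp
    then have one: "?h (?s \<otimes>\<^bsub>sections P ?W\<^esub> inv\<^bsub>sections P ?W\<^esub> ?s') = \<one>\<^bsub>sections Q V\<^esub>"
      using cl by simp
    have fyW: "f y \<in> ?W" and u: "?s \<otimes>\<^bsub>sections P ?W\<^esub> inv\<^bsub>sections P ?W\<^esub> ?s' \<in> carrier (sections P ?W)"
      using cl fy by simp_all
    obtain R where R: "openin Z R" "f y \<in> R" "R \<subseteq> ?W"
      "restr P ?W R (?s \<otimes>\<^bsub>sections P ?W\<^esub> inv\<^bsub>sections P ?W\<^esub> ?s') = \<one>\<^bsub>sections P R\<^esub>"
      using stalk_inj[OF o(1) fy(3) fyW u V(1,2) VW one] by (elim exE conjE)
    interpret GR: comm_group "sections P R" using presheaf_P R(1) by (rule presheaf_group)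
    interpret rr: group_hom "sections P ?W" "sections P R" "restr P ?W R"
      using presheaf_hom[OF presheaf_P o(1) R(1,3)] by unfold_locales
    have "restr P ?W R ?s = restr P ?W R ?s'"
      using R(4) cl GR.inv_solve_right'[of "\<one>\<^bsub>sections P R\<^esub>"] by simp
    moreover have "restr P ?W R ?s = restr P W R s" "restr P ?W R ?s' = restr P W' R s'"
      using W W' o R by (simp_all add: presheaf_restr_restr[OF presheaf_P])
    ultimately show "\<exists>R. openin Z R \<and> f y \<in> R \<and> R \<subseteq> W \<and> R \<subseteq> W' \<and> restr P W R s = restr P W' R s'"
      using R by auto
  next
    assume "\<exists>R. openin Z R \<and> f y \<in> R \<and> R \<subseteq> W \<and> R \<subseteq> W' \<and> restr P W R s = restr P W' R s'"
    then obtain R where R: "openin Z R" "f y \<in> R" "R \<subseteq> W" "R \<subseteq> W'" "restr P W R s = restr P W' R s'"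
      by auto
    have "restr Q (pre W) (pre R) (r W s) = restr Q (pre W') (pre R) (r W' s')"
      using r_restr[OF W(1) R(1,3) W(2)] r_restr[OF W'(1) R(1,4) W'(2)] R(5) by simp
    moreover have "pre R \<in> nbhd_filter Y y"
      using open_pre[OF R(1)] R(2) fy(3) by (simp add: mem_nbhd_filter mem_pre)
    ultimately show "germ Q (nbhd_filter Y y) (pre W) (r W s) =
      germ Q (nbhd_filter Y y) (pre W') (r W' s')"
      by (intro Q.germ_eqI[where W = "pre R"] pre r_closed W W' preimage_mono R)
  qed
qed

lemma germ_pull_total:
  assumes V: "openin Y V" and y: "y \<in> V" and a: "a \<in> carrier (sections IP V)"
  obtains W s where "openin Z W" "s \<in> carrier (sections P W)" "y \<in> pre W"
    "germ IP (nbhd_filter Y y) V a = germ IP (nbhd_filter Y y) (pre W) (pull W s)"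
proof -
  interpret IP: directed_colimit Y IP "nbhd_filter Y y"
    by (rule stalk_colimit[OF presheaf_IP V y])
  interpret V: directed_colimit Z S "nbhds_of_image Z f V"
    by (rule nbhds_of_image_colimit[OF presheaf_S image_open[OF V]])
  obtain W0 \<sigma> where W0: "W0 \<in> nbhds_of_image Z f V" "\<sigma> \<in> carrier (sections S W0)"
    "a = germ S (nbhds_of_image Z f V) W0 \<sigma>"
    using a unfolding inverse_image_presheaf_sections by (rule V.colimE)
  have W0': "openin Z W0" "f ` V \<subseteq> W0" using W0(1) by (simp_all add: nbhds_of_image_def)
  then have "f y \<in> W0" using y by blast
  with W0(2) obtain W s where W: "openin Z W" "f y \<in> W" "W \<subseteq> W0" "s \<in> carrier (sections P W)"
    "\<forall>z\<in>W. \<sigma> z = germ P (nbhd_filter Z z) W s"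
    by (rule sheafify_carrierE)
  let ?V = "V \<inter> pre W"
  have yW: "y \<in> pre W" using V y W(2) openin_subset[OF V] by (auto simp: preimage_def)
  have oV: "openin Y ?V" using V open_pre[OF W(1)] by blast
  interpret V2: directed_colimit Z S "nbhds_of_image Z f ?V"
    by (rule nbhds_of_image_colimit[OF presheaf_S image_open[OF oV]])
  have WV: "W \<in> nbhds_of_image Z f ?V" by (rule nbhds_of_image_pre[OF W(1)]) simp
  have "germ S (nbhds_of_image Z f ?V) W0 \<sigma> = germ S (nbhds_of_image Z f ?V) W (germs Z P W s)"
  proof (rule V2.germ_eqI[where W = W])
    show "restr S W0 W \<sigma> = restr S W W (germs Z P W s)"
      using W(5) by (simp add: sheafify_restr germs_def cong: restrict_cong)
    show "W0 \<in> nbhds_of_image Z f ?V" using W0' by (auto simp: nbhds_of_image_def)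
  qed (use W0 W WV germs_closed[OF presheaf_P W(1,4)] in simp_all)
  then have "restr IP V ?V a = restr IP (pre W) ?V (pull W s)"
    unfolding W0(3) pull_restr[OF W(1,4) Int_lower2]
      inverse_image_presheaf_restr_germ[OF presheaf_S image_open[OF V] Int_lower1 W0(1,2)] .
  then have "germ IP (nbhd_filter Y y) V a = germ IP (nbhd_filter Y y) (pre W) (pull W s)"
    using V y a W yW oV
    by (intro IP.germ_eqI[where W = ?V] pull_closed) (simp_all add: mem_nbhd_filter open_pre)
  then show ?thesis using that W yW by blast
qed

text \<open>A relation instead of a map, because a section of \<open>IP\<close> comes from a section
  of \<open>P\<close> only locally. Related pairs are the two images of one section \<open>s\<close>
  of \<open>P\<close> over \<open>W\<close>.\<close>

definition corr where
  "corr V a b \<longleftrightarrow> (\<exists>W s. openin Z W \<and> s \<in> carrier (sections P W) \<and>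
     V = pre W \<and> a = pull W s \<and> b = r W s)"

lemma corrI: "openin Z W \<Longrightarrow> s \<in> carrier (sections P W) \<Longrightarrow> corr (pre W) (pull W s) (r W s)"
  unfolding corr_def by (intro exI conjI) simp_all

lemma corrE:
  assumes "corr V a b"
  obtains W s where "openin Z W" "s \<in> carrier (sections P W)" "V = pre W" "a = pull W s" "b = r W s"
  using assms unfolding corr_def by (elim exE conjE)

lemma corr_stalk_correspondence: "stalk_correspondence Y IP Q corr"
proof
  show "is_presheaf Y IP" by (rule presheaf_IP)
  show "is_presheaf Y Q" by (rule presheaf_Q)
next
  fix V a b assume "corr V a b"
  then show "openin Y V \<and> a \<in> carrier (sections IP V) \<and> b \<in> carrier (sections Q V)"
    by (rule corrE) (simp add: open_pre pull_closed r_closed)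
next
  fix V y a assume "openin Y V" "y \<in> V" "a \<in> carrier (sections IP V)"
  then obtain W s where "openin Z W" "s \<in> carrier (sections P W)" "y \<in> pre W"
    "germ IP (nbhd_filter Y y) V a = germ IP (nbhd_filter Y y) (pre W) (pull W s)"
    by (rule germ_pull_total)
  then show "\<exists>V' a' b'. corr V' a' b' \<and> y \<in> V' \<and>
      germ IP (nbhd_filter Y y) V a = germ IP (nbhd_filter Y y) V' a'"
    using corrI[of W s] by (intro exI conjI)
next
  fix V y q assume V: "openin Y V" "y \<in> V" "q \<in> carrier (sections Q V)"
  obtain W s V' where W: "openin Z W" "f y \<in> W" "s \<in> carrier (sections P W)"
    "openin Y V'" "y \<in> V'" "V' \<subseteq> V" "V' \<subseteq> pre W"
    "restr Q V V' q = restr Q (pre W) V' (r W s)"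
    using stalk_surj[OF V] by (elim exE conjE)
  interpret Q: directed_colimit Y Q "nbhd_filter Y y"
    by (rule stalk_colimit[OF presheaf_Q V(1,2)])
  have yW: "y \<in> pre W" using W by blast
  have "germ Q (nbhd_filter Y y) V q = germ Q (nbhd_filter Y y) (pre W) (r W s)"
    using V W yW by (intro Q.germ_eqI[where W = V'] r_closed) (simp_all add: mem_nbhd_filter open_pre)
  then show "\<exists>V' a' b'. corr V' a' b' \<and> y \<in> V' \<and>
      germ Q (nbhd_filter Y y) V q = germ Q (nbhd_filter Y y) V' b'"
    using corrI[OF W(1,3)] yW by (intro exI conjI)
next
  fix V a b V' a' b' y
  assume L: "corr V a b" "corr V' a' b'" and y: "y \<in> V" "y \<in> V'"
  obtain W s where W: "openin Z W" "s \<in> carrier (sections P W)" "V = pre W" "a = pull W s" "b = r W s"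
    using L(1) by (rule corrE)
  obtain W' s' where W': "openin Z W'" "s' \<in> carrier (sections P W')"
    "V' = pre W'" "a' = pull W' s'" "b' = r W' s'"
    using L(2) by (rule corrE)
  note y' = y[unfolded W(3) W'(3)]
  show "germ IP (nbhd_filter Y y) V a = germ IP (nbhd_filter Y y) V' a' \<longleftrightarrow>
    germ Q (nbhd_filter Y y) V b = germ Q (nbhd_filter Y y) V' b'"
    unfolding W(3-5) W'(3-5) pull_germ_eq_iff[OF W(1,2) W'(1,2) y'] r_germ_eq_iff[OF W(1,2) W'(1,2) y'] ..
  \<comment> \<open>For multiplicativity both sections of \<open>P\<close> are moved to
    \<open>W \<inter> W'\<close> and multiplied there. \<open>pull\<close> and \<open>r\<close>
    preserve this product, so its two images are the required related pair.\<close>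
  let ?R = "W \<inter> W'"
  let ?s = "restr P W ?R s" and ?s' = "restr P W' ?R s'"
  have R: "openin Z ?R" using W W' by blast
  have yR: "y \<in> pre ?R" using y' by (auto simp: preimage_def)
  have fy: "f y \<in> ?R" using yR by (simp add: preimage_def)
  have cl: "?s \<in> carrier (sections P ?R)" "?s' \<in> carrier (sections P ?R)"
    using W W' R by (simp_all add: presheaf_restr_closed[OF presheaf_P])
  \<comment> \<open>These are the criteria of \<open>pull_germ_eq_iff\<close> and
    \<open>r_germ_eq_iff\<close> with \<open>?R\<close> itself as witness: neither the germ of the
    pulled section nor that of its image under \<open>r\<close> changes when \<open>s\<close> or
    \<open>s'\<close> is restricted to \<open>?R\<close>.\<close>
  have same: "\<exists>T. openin Z T \<and> f y \<in> T \<and> T \<subseteq> ?R \<and> T \<subseteq> W \<and> restr P ?R T ?s = restr P W T s"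
    "\<exists>T. openin Z T \<and> f y \<in> T \<and> T \<subseteq> ?R \<and> T \<subseteq> W' \<and> restr P ?R T ?s' = restr P W' T s'"
    using R fy cl by (intro exI[of _ ?R], simp add: presheaf_restr_id[OF presheaf_P])+
  interpret IP: directed_colimit Y IP "nbhd_filter Y y"
    by (rule stalk_colimit[OF presheaf_IP open_pre[OF R] yR])
  interpret Q: directed_colimit Y Q "nbhd_filter Y y"
    by (rule stalk_colimit[OF presheaf_Q open_pre[OF R] yR])
  have nR: "pre ?R \<in> nbhd_filter Y y" using open_pre[OF R] yR by (simp add: mem_nbhd_filter)
  have "germ IP (nbhd_filter Y y) (pre ?R) (pull ?R (?s \<otimes>\<^bsub>sections P ?R\<^esub> ?s')) =
      germ IP (nbhd_filter Y y) V a \<otimes>\<^bsub>stalk Y IP y\<^esub> germ IP (nbhd_filter Y y) V' a'"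
    unfolding pull_mult[OF R cl] IP.germ_mult[OF nR pull_closed[OF R cl(1)] pull_closed[OF R cl(2)]]
    using pull_germ_eq_iff[OF R cl(1) W(1,2) yR y'(1)] pull_germ_eq_iff[OF R cl(2) W'(1,2) yR y'(2)] same
    unfolding W(3-5) W'(3-5) by simp
  moreover have "germ Q (nbhd_filter Y y) (pre ?R) (r ?R (?s \<otimes>\<^bsub>sections P ?R\<^esub> ?s')) =
      germ Q (nbhd_filter Y y) V b \<otimes>\<^bsub>stalk Y Q y\<^esub> germ Q (nbhd_filter Y y) V' b'"
    unfolding hom_mult[OF r_in_hom[OF R] cl] Q.germ_mult[OF nR r_closed[OF R cl(1)] r_closed[OF R cl(2)]]
    using r_germ_eq_iff[OF R cl(1) W(1,2) yR y'(1)] r_germ_eq_iff[OF R cl(2) W'(1,2) yR y'(2)] same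
    unfolding W(3-5) W'(3-5) by simp
  ultimately show "\<exists>V'' a'' b''. corr V'' a'' b'' \<and> y \<in> V'' \<and>
      germ IP (nbhd_filter Y y) V'' a'' =
        germ IP (nbhd_filter Y y) V a \<otimes>\<^bsub>stalk Y IP y\<^esub> germ IP (nbhd_filter Y y) V' a' \<and>
      germ Q (nbhd_filter Y y) V'' b'' =
        germ Q (nbhd_filter Y y) V b \<otimes>\<^bsub>stalk Y Q y\<^esub> germ Q (nbhd_filter Y y) V' b'"
    using corrI[OF R presheaf_mult_closed[OF presheaf_P R cl]] yR
    by (intro exI conjI)
qed

text \<open>The unit at \<open>germs Z P W s\<close> unfolds to the germs of
  \<open>pull W s\<close>, which is related to \<open>r W s\<close> by \<open>corr\<close>. So the
  formula for \<open>\<theta>\<close> is an instance of \<open>section_map_germs\<close>.\<close>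

theorem inverse_image_iso:
  "\<exists>\<theta>. sheaf_iso Y (inverse_image Y Z f S) (sheafify Y Q) \<theta> \<and>
     (\<forall>W s. openin Z W \<longrightarrow> s \<in> carrier (sections P W) \<longrightarrow>
        \<theta> (pre W) (inverse_image_unit Y Z f S W (germs Z P W s)) = germs Y Q (pre W) (r W s))"
proof -
  interpret stalk_correspondence Y IP Q corr by (rule corr_stalk_correspondence)
  show ?thesis
    using section_map_iso section_map_germs[OF corrI]
    by (intro exI[of _ section_map]) (simp add: inverse_image_def inverse_image_unit_def pull_def)
qed

text \<open>If the sheaf associated to \<open>P\<close> vanishes, \<open>pull W s\<close> equals
  \<open>pull W \<one>\<close> for every \<open>s\<close>. By \<open>germ_iff\<close> the germs of
  \<open>r W s\<close> are then trivial, and by \<open>right_total\<close> every germ of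
  \<open>Q\<close> is of this kind.\<close>

theorem zero_sheafify:
  assumes zero: "zero_sheaf Z S"
  shows "zero_sheaf Y (sheafify Y Q)"
  unfolding zero_sheaf_def
proof (intro allI impI)
  fix V assume V: "openin Y V"
  interpret G: comm_group "sections (sheafify Y Q) V"
    by (rule sheafify_comm_group[OF presheaf_Q V])
  interpret C: stalk_correspondence Y IP Q corr by (rule corr_stalk_correspondence)
  have "\<sigma> = \<one>\<^bsub>sections (sheafify Y Q) V\<^esub>" if \<sigma>: "\<sigma> \<in> carrier (sections (sheafify Y Q) V)" for \<sigma>
  proof (rule extensionalityI[of _ V])
    show "\<sigma> \<in> extensional V" using \<sigma> by (simp add: sheafify_carrier_iff[OF presheaf_Q V])
    fix y assume y: "y \<in> V"
    obtain V' q where V': "openin Y V'" "y \<in> V'" "V' \<subseteq> V" "q \<in> carrier (sections Q V')"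
      "\<forall>z\<in>V'. \<sigma> z = germ Q (nbhd_filter Y z) V' q"
      using \<sigma> y by (rule sheafify_carrierE)
    obtain U a b where U: "corr U a b" "y \<in> U"
      "germ Q (nbhd_filter Y y) V' q = germ Q (nbhd_filter Y y) U b"
      using C.right_total[OF V'(1,2,4)] by (elim exE conjE)
    obtain W s where W: "openin Z W" "s \<in> carrier (sections P W)" "U = pre W" "a = pull W s" "b = r W s"
      using U(1) by (rule corrE)
    have one: "\<one>\<^bsub>sections P W\<^esub> \<in> carrier (sections P W)"
      by (rule presheaf_one_closed[OF presheaf_P W(1)])
    have "germs Z P W s = germs Z P W \<one>\<^bsub>sections P W\<^esub>"
      using zero W(1) germs_closed[OF presheaf_P W(1,2)] germs_closed[OF presheaf_P W(1) one]
      by (simp add: zero_sheaf_def)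
    then have "pull W s = pull W \<one>\<^bsub>sections P W\<^esub>" by (simp add: pull_def)
    then have "germ Q (nbhd_filter Y y) (pre W) (r W s) =
      germ Q (nbhd_filter Y y) (pre W) (r W \<one>\<^bsub>sections P W\<^esub>)"
      using C.germ_iff[OF corrI[OF W(1,2)] corrI[OF W(1) one]] U(2) W(3) by simp
    also have "r W \<one>\<^bsub>sections P W\<^esub> = \<one>\<^bsub>sections Q (pre W)\<^esub>"
      using r_in_hom[OF W(1)] presheaf_is_group[OF presheaf_P W(1)]
        presheaf_is_group[OF presheaf_Q open_pre[OF W(1)]] by (rule hom_one)
    also have "germ Q (nbhd_filter Y y) (pre W) \<dots> = \<one>\<^bsub>stalk Y Q y\<^esub>"
      using U(2) W(1,3) open_pre
      by (intro directed_colimit.germ_one[OF stalk_colimit[OF presheaf_Q V y]])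
        (simp add: mem_nbhd_filter)
    finally show "\<sigma> y = \<one>\<^bsub>sections (sheafify Y Q) V\<^esub> y"
      using V' U(3) W(3,5) y by (simp add: sheafify_one)
  qed (simp add: sheafify_one)
  then show "carrier (sections (sheafify Y Q) V) = {\<one>\<^bsub>sections (sheafify Y Q) V\<^esub>}"
    by auto
qed

end

section \<open>Subquotients and cohomology presheaves\<close>

text \<open>Cosets and their products depend on the multiplication alone. Computations in a
  subquotient can therefore be carried out in the ambient group, ignoring the smaller carrier of
  cocycles.\<close>

lemma r_coset_carrier_update: "H #>\<^bsub>G\<lparr>carrier := Z\<rparr>\<^esub> c = H #>\<^bsub>G\<^esub> c"
  by (simp add: r_coset_def)

lemma set_mult_carrier_update: "A <#>\<^bsub>G\<lparr>carrier := Z\<rparr>\<^esub> B = A <#>\<^bsub>G\<^esub> B"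
  by (simp add: set_mult_def)

lemma subquotient_carrier:
  "carrier (G\<lparr>carrier := Z\<rparr> Mod B) = {B #>\<^bsub>G\<^esub> c |c. c \<in> Z}"
  by (auto simp: carrier_FactGroup r_coset_carrier_update)

lemma subquotient_mult:
  assumes "comm_group G" "subgroup B G" "c \<in> carrier G" "d \<in> carrier G"
  shows "(B #>\<^bsub>G\<^esub> c) \<otimes>\<^bsub>G\<lparr>carrier := Z\<rparr> Mod B\<^esub> (B #>\<^bsub>G\<^esub> d) = B #>\<^bsub>G\<^esub> (c \<otimes>\<^bsub>G\<^esub> d)"
  using normal.rcos_sum[OF comm_group.subgroup_imp_normal[OF assms(1,2)] assms(3,4)]
  by (simp add: set_mult_carrier_update)

lemma subquotient_comm_group:
  assumes "comm_group G" "subgroup Z G" "subgroup B G" "B \<subseteq> Z"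
  shows "comm_group (G\<lparr>carrier := Z\<rparr> Mod B)"
proof -
  interpret G: comm_group G by fact
  have "group (G\<lparr>carrier := Z\<rparr>)" by (rule G.subgroup_imp_group[OF assms(2)])
  then have "comm_group (G\<lparr>carrier := Z\<rparr>)"
    using subgroup.mem_carrier[OF assms(2)]
    by (intro group.group_comm_groupI) (simp_all add: G.m_comm)
  then show ?thesis
    by (rule comm_group.abelian_FactGroup[OF _ G.subgroup_incl[OF assms(3,2,4)]])
qed

text \<open>The image under \<open>h\<close> of a coset of \<open>B\<close> is in general only part
  of a coset of \<open>B'\<close>; multiplying by \<open>B'\<close> fills it up. This explains the
  shape of the restriction maps of the cohomology presheaf.\<close>

lemma subquotient_map_coset:
  assumes "group G" "group H" "h \<in> hom G H" "subgroup B G" "subgroup B' H" "h ` B \<subseteq> B'"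
    and c: "c \<in> carrier G"
  shows "B' <#>\<^bsub>H\<^esub> (h ` (B #>\<^bsub>G\<^esub> c)) = B' #>\<^bsub>H\<^esub> h c"
proof -
  interpret G: group G by fact
  interpret H: group H by fact
  interpret h: group_hom G H h using assms(3) by unfold_locales
  have B: "b \<in> carrier G" if "b \<in> B" for b using that by (rule subgroup.mem_carrier[OF assms(4)])
  have B': "b \<in> carrier H" if "b \<in> B'" for b using that by (rule subgroup.mem_carrier[OF assms(5)])
  have "b' \<otimes>\<^bsub>H\<^esub> h (b \<otimes>\<^bsub>G\<^esub> c) \<in> B' #>\<^bsub>H\<^esub> h c" if b: "b' \<in> B'" "b \<in> B" for b b'
  proof -
    have hb: "h b \<in> B'" using b assms(6) by blast
    have "b' \<otimes>\<^bsub>H\<^esub> h (b \<otimes>\<^bsub>G\<^esub> c) = (b' \<otimes>\<^bsub>H\<^esub> h b) \<otimes>\<^bsub>H\<^esub> h c"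
      using B B' b c by (simp add: H.m_assoc)
    then show ?thesis
      using subgroup.m_closed[OF assms(5) b(1) hb] by (auto simp: r_coset_def)
  qed
  moreover have "b' \<otimes>\<^bsub>H\<^esub> h c \<in> B' <#>\<^bsub>H\<^esub> (h ` (B #>\<^bsub>G\<^esub> c))" if "b' \<in> B'" for b'
  proof -
    have "c \<in> B #>\<^bsub>G\<^esub> c" using G.rcos_self[OF c assms(4)] .
    then show ?thesis using that by (auto simp: set_mult_def)
  qed
  ultimately show ?thesis by (auto simp: set_mult_def r_coset_def)
qed

lemma subquotient_map_hom:
  assumes G: "comm_group G" and H: "comm_group H" and h: "h \<in> hom G H"
    and Z: "subgroup Z G" "subgroup Z' H" "h ` Z \<subseteq> Z'"
    and B: "subgroup B G" "subgroup B' H" "h ` B \<subseteq> B'"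
  shows "(\<lambda>a. B' <#>\<^bsub>H\<^esub> (h ` a)) \<in> hom (G\<lparr>carrier := Z\<rparr> Mod B) (H\<lparr>carrier := Z'\<rparr> Mod B')"
proof -
  interpret G: comm_group G by fact
  interpret H: comm_group H by fact
  have ZG: "c \<in> carrier G" if "c \<in> Z" for c using that by (rule subgroup.mem_carrier[OF Z(1)])
  have hZ: "h c \<in> Z'" if "c \<in> Z" for c using that Z(3) by blast
  note q = subquotient_map_coset[OF G.group_axioms H.group_axioms h B]
  show ?thesis
  proof (rule homI)
    fix a assume "a \<in> carrier (G\<lparr>carrier := Z\<rparr> Mod B)"
    then show "B' <#>\<^bsub>H\<^esub> (h ` a) \<in> carrier (H\<lparr>carrier := Z'\<rparr> Mod B')"
      using q ZG hZ by (auto simp: subquotient_carrier)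
  next
    fix a b assume "a \<in> carrier (G\<lparr>carrier := Z\<rparr> Mod B)" "b \<in> carrier (G\<lparr>carrier := Z\<rparr> Mod B)"
    then obtain c d where cd: "c \<in> Z" "a = B #>\<^bsub>G\<^esub> c" "d \<in> Z" "b = B #>\<^bsub>G\<^esub> d"
      by (auto simp: subquotient_carrier)
    have cl: "c \<in> carrier G" "d \<in> carrier G" using ZG cd by blast+
    show "B' <#>\<^bsub>H\<^esub> (h ` (a \<otimes>\<^bsub>G\<lparr>carrier := Z\<rparr> Mod B\<^esub> b)) =
      (B' <#>\<^bsub>H\<^esub> (h ` a)) \<otimes>\<^bsub>H\<lparr>carrier := Z'\<rparr> Mod B'\<^esub> (B' <#>\<^bsub>H\<^esub> (h ` b))"
      unfolding cd subquotient_mult[OF G B(1) cl] q[OF cl(1)] q[OF cl(2)] q[OF G.m_closed[OF cl]]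
        subquotient_mult[OF H B(2) hom_in_carrier[OF h cl(1)] hom_in_carrier[OF h cl(2)]]
        hom_mult[OF h cl] ..
  qed
qed

section \<open>Sections of the image sheaf of a morphism\<close>

lemma image_sectionsE:
  assumes "s \<in> image_sections X F G \<eta> U" "x \<in> U"
  obtains V a where "openin X V" "x \<in> V" "V \<subseteq> U" "a \<in> carrier (sections F V)"
    "restr G U V s = \<eta> V a"
  using assms by (auto simp: image_sections_def)

text \<open>Having a preimage is a local condition: around each point, preimages of two factors live
  on different neighbourhoods and are multiplied on the intersection of these.\<close>

lemma image_sections_subgroup:
  assumes F: "is_presheaf X F" and G: "is_presheaf X G" and \<eta>: "sheaf_hom X F G \<eta>"
    and U: "openin X U"
  shows "subgroup (image_sections X F G \<eta> U) (sections G U)"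
proof -
  interpret GU: comm_group "sections G U" using presheaf_group[OF G U] .
  have \<eta>_hom: "group_hom (sections F V) (sections G V) (\<eta> V)" if "openin X V" for V
    using \<eta> presheaf_is_group[OF F that] presheaf_is_group[OF G that] that
    by (simp add: group_hom_def group_hom_axioms_def sheaf_hom_def)
  have restr_hom: "group_hom (sections G U) (sections G V) (restr G U V)"
    if "openin X V" "V \<subseteq> U" for V
    using presheaf_hom[OF G U that] presheaf_is_group[OF G U] presheaf_is_group[OF G that(1)]
    by (simp add: group_hom_def group_hom_axioms_def)
  show ?thesis
  proof
    show "image_sections X F G \<eta> U \<subseteq> carrier (sections G U)"
      by (auto simp: image_sections_def)
    show "\<one>\<^bsub>sections G U\<^esub> \<in> image_sections X F G \<eta> U"
      unfolding image_sections_def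
    proof (safe, simp)
      fix x assume x: "x \<in> U"
      have "restr G U U \<one>\<^bsub>sections G U\<^esub> = \<eta> U \<one>\<^bsub>sections F U\<^esub>"
        using presheaf_restr_one[OF G U U] group_hom.hom_one[OF \<eta>_hom[OF U]] by simp
      then show "\<exists>V. openin X V \<and> x \<in> V \<and> V \<subseteq> U \<and>
          restr G U V \<one>\<^bsub>sections G U\<^esub> \<in> \<eta> V ` carrier (sections F V)"
        using U x presheaf_one_closed[OF F U] by (intro exI[of _ U]) auto
    qed
  next
    fix s t assume s: "s \<in> image_sections X F G \<eta> U" and t: "t \<in> image_sections X F G \<eta> U"
    have st: "s \<in> carrier (sections G U)" "t \<in> carrier (sections G U)"
      using s t by (simp_all add: image_sections_def)
    show "s \<otimes>\<^bsub>sections G U\<^esub> t \<in> image_sections X F G \<eta> U"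
      unfolding image_sections_def
    proof (intro CollectI conjI ballI)
      fix x assume x: "x \<in> U"
      obtain V a where V: "openin X V" "x \<in> V" "V \<subseteq> U" "a \<in> carrier (sections F V)"
        "restr G U V s = \<eta> V a"
        using s x by (rule image_sectionsE)
      obtain V' b where V': "openin X V'" "x \<in> V'" "V' \<subseteq> U" "b \<in> carrier (sections F V')"
        "restr G U V' t = \<eta> V' b"
        using t x by (rule image_sectionsE)
      let ?W = "V \<inter> V'"
      have W: "openin X ?W" "?W \<subseteq> U" using V V' by auto
      interpret e: group_hom "sections F ?W" "sections G ?W" "\<eta> ?W" by (rule \<eta>_hom[OF W(1)])
      interpret rr: group_hom "sections G U" "sections G ?W" "restr G U ?W" by (rule restr_hom[OF W])
      have "restr G U ?W s = \<eta> ?W (restr F V ?W a)"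
        using presheaf_restr_restr[OF G U V(1) W(1) _ V(3) st(1)] V W \<eta> by (simp add: sheaf_hom_def)
      moreover have "restr G U ?W t = \<eta> ?W (restr F V' ?W b)"
        using presheaf_restr_restr[OF G U V'(1) W(1) _ V'(3) st(2)] V' W \<eta> by (simp add: sheaf_hom_def)
      moreover have cl: "restr F V ?W a \<in> carrier (sections F ?W)" "restr F V' ?W b \<in> carrier (sections F ?W)"
        using V V' W by (simp_all add: presheaf_restr_closed[OF F])
      ultimately have "restr G U ?W (s \<otimes>\<^bsub>sections G U\<^esub> t) =
          \<eta> ?W (restr F V ?W a \<otimes>\<^bsub>sections F ?W\<^esub> restr F V' ?W b)"
        using st by simp
      then show "\<exists>V. openin X V \<and> x \<in> V \<and> V \<subseteq> U \<and>
          restr G U V (s \<otimes>\<^bsub>sections G U\<^esub> t) \<in> \<eta> V ` carrier (sections F V)"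
        using W V V' imageI[OF e.G.m_closed[OF cl], of "\<eta> ?W"] by (intro exI[of _ ?W]) simp
    qed (use st in simp)
  next
    fix s assume s: "s \<in> image_sections X F G \<eta> U"
    have sc: "s \<in> carrier (sections G U)" using s by (simp add: image_sections_def)
    show "inv\<^bsub>sections G U\<^esub> s \<in> image_sections X F G \<eta> U"
      unfolding image_sections_def
    proof (intro CollectI conjI ballI)
      fix x assume x: "x \<in> U"
      obtain V a where V: "openin X V" "x \<in> V" "V \<subseteq> U" "a \<in> carrier (sections F V)"
        "restr G U V s = \<eta> V a"
        using s x by (rule image_sectionsE)
      interpret e: group_hom "sections F V" "sections G V" "\<eta> V" by (rule \<eta>_hom[OF V(1)])
      interpret rr: group_hom "sections G U" "sections G V" "restr G U V" by (rule restr_hom[OF V(1,3)])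
      have "restr G U V (inv\<^bsub>sections G U\<^esub> s) = \<eta> V (inv\<^bsub>sections F V\<^esub> a)"
        using V sc by simp
      then show "\<exists>V. openin X V \<and> x \<in> V \<and> V \<subseteq> U \<and>
          restr G U V (inv\<^bsub>sections G U\<^esub> s) \<in> \<eta> V ` carrier (sections F V)"
        using V imageI[OF e.G.inv_closed[OF V(4)], of "\<eta> V"] by (intro exI[of _ V]) simp
    qed (use sc in simp)
  qed
qed

lemma image_sections_restr:
  assumes F: "is_presheaf X F" and G: "is_presheaf X G" and \<eta>: "sheaf_hom X F G \<eta>"
    and U: "openin X U" and V: "openin X V" "V \<subseteq> U" and s: "s \<in> image_sections X F G \<eta> U"
  shows "restr G U V s \<in> image_sections X F G \<eta> V"
  unfolding image_sections_def
proof (intro CollectI conjI ballI)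
  have sc: "s \<in> carrier (sections G U)" using s by (simp add: image_sections_def)
  then show "restr G U V s \<in> carrier (sections G V)" by (rule presheaf_restr_closed[OF G U V])
  fix x assume x: "x \<in> V"
  with V have xU: "x \<in> U" by blast
  obtain V' a where V': "openin X V'" "x \<in> V'" "V' \<subseteq> U" "a \<in> carrier (sections F V')"
    "restr G U V' s = \<eta> V' a"
    using s xU by (rule image_sectionsE)
  let ?W = "V \<inter> V'"
  have W: "openin X ?W" using V V' by auto
  have "restr G V ?W (restr G U V s) = restr G V' ?W (restr G U V' s)"
    using presheaf_restr_restr[OF G U V(1) W _ V(2) sc] presheaf_restr_restr[OF G U V'(1) W _ V'(3) sc]
    by simp
  also have "\<dots> = \<eta> ?W (restr F V' ?W a)"
    using V' W \<eta> by (simp add: sheaf_hom_def)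
  finally show "\<exists>W. openin X W \<and> x \<in> W \<and> W \<subseteq> V \<and>
      restr G V W (restr G U V s) \<in> \<eta> W ` carrier (sections F W)"
    using x V' W presheaf_restr_closed[OF F V'(1) W _ V'(4)] by (intro exI[of _ ?W]) auto
qed

text \<open>The complex condition has the form of an inclusion because coboundaries are only locally
  boundaries. Triviality of the composite of two differentials would show that the differential of a
  coboundary is locally trivial; passing from this to triviality takes separatedness, which
  presheaves do not provide.\<close>

locale presheaf_complex =
  fixes X :: "'x topology" and C :: "('x, 'u) cochain"
  assumes obj_presheaf: "is_presheaf X (obj C n)"
    and diff_hom: "sheaf_hom X (obj C n) (obj C (Suc n)) (diff C n)"
    and coboundaries_cocycles: "openin X U \<Longrightarrow> coboundaries X C n U \<subseteq> cocycles C n U"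
begin

lemma diff_group_hom:
  "openin X U \<Longrightarrow> group_hom (sections (obj C n) U) (sections (obj C (Suc n)) U) (diff C n U)"
  using diff_hom[of n] presheaf_is_group[OF obj_presheaf]
  by (simp add: group_hom_def group_hom_axioms_def sheaf_hom_def)

lemma diff_restr:
  "openin X U \<Longrightarrow> openin X V \<Longrightarrow> V \<subseteq> U \<Longrightarrow> s \<in> carrier (sections (obj C n) U) \<Longrightarrow>
     diff C n V (restr (obj C n) U V s) = restr (obj C (Suc n)) U V (diff C n U s)"
  using diff_hom[of n] by (simp add: sheaf_hom_def)

lemma cocycles_subgroup: "openin X U \<Longrightarrow> subgroup (cocycles C n U) (sections (obj C n) U)"
  unfolding cocycles_def kernel_sections_def by (rule group_hom.subgroup_kernel[OF diff_group_hom])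

lemma coboundaries_subgroup:
  assumes "openin X U"
  shows "subgroup (coboundaries X C n U) (sections (obj C n) U)"
proof (cases n)
  case 0
  then show ?thesis
    using group.triv_subgroup[OF presheaf_is_group[OF obj_presheaf assms]]
    by (simp add: coboundaries_def)
next
  case (Suc m)
  then show ?thesis
    using image_sections_subgroup[OF obj_presheaf obj_presheaf diff_hom assms]
    by (simp add: coboundaries_def)
qed

lemma cocycles_carrier: "c \<in> cocycles C n U \<Longrightarrow> c \<in> carrier (sections (obj C n) U)"
  by (simp add: cocycles_def kernel_sections_def kernel_def)

lemma cocycles_restr:
  assumes U: "openin X U" and V: "openin X V" "V \<subseteq> U" and c: "c \<in> cocycles C n U"
  shows "restr (obj C n) U V c \<in> cocycles C n V"
proof -
  have "c \<in> carrier (sections (obj C n) U)" "diff C n U c = \<one>\<^bsub>sections (obj C (Suc n)) U\<^esub>"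
    using c by (simp_all add: cocycles_def kernel_sections_def kernel_def)
  then show ?thesis
    using diff_restr[OF U V] presheaf_restr_closed[OF obj_presheaf U V]
      presheaf_restr_one[OF obj_presheaf U V]
    by (simp add: cocycles_def kernel_sections_def kernel_def)
qed

lemma coboundaries_restr:
  assumes "openin X U" "openin X V" "V \<subseteq> U" "c \<in> coboundaries X C n U"
  shows "restr (obj C n) U V c \<in> coboundaries X C n V"
proof (cases n)
  case 0
  then show ?thesis
    using assms presheaf_restr_one[OF obj_presheaf] by (simp add: coboundaries_def)
next
  case (Suc m)
  then show ?thesis
    using assms image_sections_restr[OF obj_presheaf obj_presheaf diff_hom]
    by (simp add: coboundaries_def)
qed

abbreviation "H n \<equiv> cohomology_presheaf X C n"

definition coho_class where
  "coho_class n U c = coboundaries X C n U #>\<^bsub>sections (obj C n) U\<^esub> c"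

lemma H_sections:
  "sections (H n) U = (sections (obj C n) U)\<lparr>carrier := cocycles C n U\<rparr> Mod coboundaries X C n U"
  by (simp add: cohomology_presheaf_def)

lemma H_carrier: "carrier (sections (H n) U) = {coho_class n U c |c. c \<in> cocycles C n U}"
  unfolding H_sections subquotient_carrier coho_class_def ..

lemma H_one: "\<one>\<^bsub>sections (H n) U\<^esub> = coboundaries X C n U"
  by (simp add: H_sections)

lemma coho_class_eq_one_iff:
  assumes "openin X U" "c \<in> cocycles C n U"
  shows "coho_class n U c = \<one>\<^bsub>sections (H n) U\<^esub> \<longleftrightarrow> c \<in> coboundaries X C n U"
  unfolding coho_class_def H_one
  using group.coset_join1[OF presheaf_is_group[OF obj_presheaf assms(1)] _ cocycles_carrier[OF assms(2)]
      coboundaries_subgroup[OF assms(1)]]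
    group.coset_join2[OF presheaf_is_group[OF obj_presheaf assms(1)] cocycles_carrier[OF assms(2)]
      coboundaries_subgroup[OF assms(1)]]
  by blast

lemma H_restr:
  assumes "openin X U" "openin X V" "V \<subseteq> U" "c \<in> cocycles C n U"
  shows "restr (H n) U V (coho_class n U c) = coho_class n V (restr (obj C n) U V c)"
  unfolding coho_class_def cohomology_presheaf_def presheaf.simps
  using coboundaries_restr[OF assms(1-3)]
  by (intro subquotient_map_coset presheaf_is_group[OF obj_presheaf] presheaf_hom[OF obj_presheaf]
      coboundaries_subgroup assms cocycles_carrier) auto

lemma cohomology_presheaf_is_presheaf: "is_presheaf X (H n)"
  unfolding is_presheaf_def
proof (intro conjI allI impI ballI; (elim conjE)?)
  fix U assume U: "openin X U"
  show "comm_group (sections (H n) U)"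
    unfolding H_sections
    by (intro subquotient_comm_group presheaf_group[OF obj_presheaf U] cocycles_subgroup
        coboundaries_subgroup coboundaries_cocycles U)
  fix a assume "a \<in> carrier (sections (H n) U)"
  then obtain c where c: "c \<in> cocycles C n U" "a = coho_class n U c" by (auto simp: H_carrier)
  show "restr (H n) U U a = a"
    unfolding c(2) H_restr[OF U U subset_refl c(1)]
      presheaf_restr_id[OF obj_presheaf U cocycles_carrier[OF c(1)]] ..
next
  fix U V assume U: "openin X U" and V: "openin X V" "V \<subseteq> U"
  show "restr (H n) U V \<in> hom (sections (H n) U) (sections (H n) V)"
    unfolding H_sections unfolding cohomology_presheaf_def presheaf.simps
    using cocycles_restr[OF U V] coboundaries_restr[OF U V]
    by (intro subquotient_map_hom presheaf_group[OF obj_presheaf] presheaf_hom[OF obj_presheaf]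
        cocycles_subgroup coboundaries_subgroup U V) auto
next
  fix U V W a
  assume U: "openin X U" and V: "openin X V" and W: "openin X W" and sub: "W \<subseteq> V" "V \<subseteq> U"
    and "a \<in> carrier (sections (H n) U)"
  then obtain c where c: "c \<in> cocycles C n U" "a = coho_class n U c" by (auto simp: H_carrier)
  show "restr (H n) V W (restr (H n) U V a) = restr (H n) U W a"
    unfolding c(2) H_restr[OF U V sub(2) c(1)] H_restr[OF V W sub(1) cocycles_restr[OF U V sub(2) c(1)]]
      H_restr[OF U W subset_trans[OF sub] c(1)]
      presheaf_restr_restr[OF obj_presheaf U V W sub cocycles_carrier[OF c(1)]] ..
qed

end

section \<open>Direct images of complexes\<close>

lemma direct_image_complex_obj:
  "sections (obj (direct_image_complex X f C) n) V = sections (obj C n) (preimage X f V)"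
  "restr (obj (direct_image_complex X f C) n) V V' = restr (obj C n) (preimage X f V) (preimage X f V')"
  "diff (direct_image_complex X f C) n V = diff C n (preimage X f V)"
  by (simp_all add: direct_image_complex_def direct_image_def)

lemma direct_image_complex_cocycles:
  "cocycles (direct_image_complex X f C) n V = cocycles C n (preimage X f V)"
  by (simp add: cocycles_def kernel_sections_def direct_image_complex_obj)

lemma direct_image_presheaf:
  assumes f: "continuous_map X Y f" and F: "is_presheaf X F"
  shows "is_presheaf Y (direct_image X f F)"
  unfolding is_presheaf_def direct_image_def presheaf.simps
  using openin_preimage[OF f] preimage_mono[of _ _ X f] presheaf_group[OF F] presheaf_hom[OF F]
    presheaf_restr_id[OF F] presheaf_restr_restr[OF F]
  by (intro conjI allI impI ballI; (elim conjE)?) simp_all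

text \<open>Coboundaries are defined by local conditions on \<open>Y\<close> while exactness of the
  resolution is local on \<open>X\<close>. A coboundary over \<open>V\<close> for the direct image
  is a section of the image sheaf on \<open>X\<close> over the inverse image of \<open>V\<close>,
  hence a cocycle by exactness. In degree 0 the only coboundary is the unit.\<close>

lemma resolution_direct_image_complex:
  assumes f: "continuous_map X Y f" and I: "injective_resolution X G \<epsilon> I"
  shows "presheaf_complex Y (direct_image_complex X f I)"
proof
  have pre: "is_presheaf X (obj I n)" for n
    using I by (simp add: injective_resolution_def injective_sheaf_def sheaf_def)
  have dhom: "sheaf_hom X (obj I n) (obj I (Suc n)) (diff I n)" for n
    using I by (simp add: injective_resolution_def)
  have exact: "image_sections X (obj I n) (obj I (Suc n)) (diff I n) U =
    kernel_sections (obj I (Suc n)) (obj I (Suc (Suc n))) (diff I (Suc n)) U" if "openin X U" for U n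
    using I that by (simp add: injective_resolution_def)
  fix n
  show "is_presheaf Y (obj (direct_image_complex X f I) n)"
    using direct_image_presheaf[OF f pre] by (simp add: direct_image_complex_def)
  show "sheaf_hom Y (obj (direct_image_complex X f I) n) (obj (direct_image_complex X f I) (Suc n))
      (diff (direct_image_complex X f I) n)"
    using dhom[of n] openin_preimage[OF f] preimage_mono[of _ _ X f]
    unfolding sheaf_hom_def direct_image_complex_obj by simp
  fix V assume V: "openin Y V"
  note pV = openin_preimage[OF f V]
  show "coboundaries Y (direct_image_complex X f I) n V \<subseteq> cocycles (direct_image_complex X f I) n V"
  proof (cases n)
    case 0
    have "\<one>\<^bsub>sections (obj I 0) (preimage X f V)\<^esub> \<in> cocycles I 0 (preimage X f V)"
      unfolding cocycles_def kernel_sections_def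
      using dhom[of 0] pV presheaf_is_group[OF pre pV]
      by (intro subgroup.one_closed group_hom.subgroup_kernel)
        (simp add: group_hom_def group_hom_axioms_def sheaf_hom_def)
    then show ?thesis
      using 0 by (simp add: coboundaries_def direct_image_complex_cocycles direct_image_complex_obj)
  next
    case (Suc m)
    \<comment> \<open>A preimage over \<open>V'\<close> is by definition a section over the inverse
      image of \<open>V'\<close>, which is a neighbourhood of every \<open>x\<close> with
      \<open>f x \<in> V'\<close>.\<close>
    have "s \<in> image_sections X (obj I m) (obj I n) (diff I m) (preimage X f V)"
      if "s \<in> coboundaries Y (direct_image_complex X f I) n V" for s
      unfolding image_sections_def
    proof (intro CollectI conjI ballI)
      show "s \<in> carrier (sections (obj I n) (preimage X f V))"
        using that Suc by (simp add: coboundaries_def image_sections_def direct_image_complex_obj)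
      fix x assume "x \<in> preimage X f V"
      then have x: "x \<in> topspace X" "f x \<in> V" by (simp_all add: preimage_def)
      have "s \<in> image_sections Y (obj (direct_image_complex X f I) m)
          (obj (direct_image_complex X f I) (Suc m)) (diff (direct_image_complex X f I) m) V"
        using that Suc by (simp add: coboundaries_def)
      then obtain V' a where V': "openin Y V'" "f x \<in> V'" "V' \<subseteq> V"
        "a \<in> carrier (sections (obj (direct_image_complex X f I) m) V')"
        "restr (obj (direct_image_complex X f I) (Suc m)) V V' s =
          diff (direct_image_complex X f I) m V' a"
        using x(2) by (rule image_sectionsE)
      then show "\<exists>W. openin X W \<and> x \<in> W \<and> W \<subseteq> preimage X f V \<and>
          restr (obj I n) (preimage X f V) W s \<in> diff I m W ` carrier (sections (obj I m) W)"
        unfolding Suc direct_image_complex_obj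
        using x openin_preimage[OF f V'(1)] preimage_mono[OF V'(3)]
        by (intro exI[of _ "preimage X f V'"]) (simp add: preimage_def direct_image_complex_obj)
    qed
    then show ?thesis
      using exact[OF pV, of m] Suc
      unfolding direct_image_complex_cocycles unfolding cocycles_def by auto
  qed
qed

section \<open>The filtrum\<close>

lemma openin_filt_basic: "openin X U \<Longrightarrow> openin (filt X) (filt_basic X U)"
  unfolding openin_filt by (rule union_of_inc) (auto simp: arbitrary_def)

lemma openin_filt_basis:
  assumes "openin (filt X) W" "F \<in> W"
  obtains U where "openin X U" "topological_filter X F" "U \<in> F" "filt_basic X U \<subseteq> W"
proof -
  obtain \<B> where \<B>: "\<And>B. B \<in> \<B> \<Longrightarrow> \<exists>U. openin X U \<and> B = filt_basic X U" "\<Union>\<B> = W"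
    using assms(1) unfolding openin_filt union_of_def by auto
  then obtain B where B: "B \<in> \<B>" "F \<in> B" using assms(2) by auto
  then obtain U where U: "openin X U" "B = filt_basic X U" using \<B>(1) by auto
  then have "topological_filter X F" "U \<in> F" "filt_basic X U \<subseteq> W"
    using B \<B>(2) by (auto simp: filt_basic_def)
  with U(1) show ?thesis by (rule that)
qed

lemma topological_filter_nbhd_filter:
  "x \<in> topspace X \<Longrightarrow> topological_filter X (nbhd_filter X x)"
  by (auto simp: topological_filter_def mem_nbhd_filter)

lemma preimage_nbhd_filter_basic:
  assumes "openin X U"
  shows "preimage X (nbhd_filter X) (filt_basic X U) = U"
  using assms openin_subset[OF assms]
  by (auto simp: preimage_def filt_basic_def mem_nbhd_filter topological_filter_nbhd_filter)

lemma continuous_map_filtI: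
  assumes "\<And>x. x \<in> topspace X \<Longrightarrow> topological_filter Z (f x)"
    and "\<And>U. openin Z U \<Longrightarrow> openin X (preimage X f (filt_basic Z U))"
  shows "continuous_map X (filt Z) f"
  unfolding continuous_map_def
proof (intro conjI allI impI)
  show "f \<in> topspace X \<rightarrow> topspace (filt Z)" using assms(1) by (simp add: topspace_filt)
  fix W assume W: "openin (filt Z) W"
  show "openin X {x \<in> topspace X. f x \<in> W}"
    unfolding openin_subopen[of X "{x \<in> topspace X. f x \<in> W}"]
  proof
    fix x assume "x \<in> {x \<in> topspace X. f x \<in> W}"
    then have x: "x \<in> topspace X" "f x \<in> W" by simp_all
    obtain U where U: "openin Z U" "topological_filter Z (f x)" "U \<in> f x" "filt_basic Z U \<subseteq> W"
      using W x(2) by (rule openin_filt_basis)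
    then show "\<exists>T. openin X T \<and> x \<in> T \<and> T \<subseteq> {x \<in> topspace X. f x \<in> W}"
      using assms(2)[OF U(1)] x
      by (intro exI[of _ "preimage X f (filt_basic Z U)"]) (auto simp: preimage_def filt_basic_def)
  qed
qed

lemma continuous_map_nbhd_filter: "continuous_map X (filt X) (nbhd_filter X)"
  by (rule continuous_map_filtI)
    (simp_all add: topological_filter_nbhd_filter preimage_nbhd_filter_basic)

text \<open>The inverse images of neighbourhoods of \<open>y\<close> are closed under finite
  intersection, so their upward closure among the open sets is already a filter and must be the
  generated one. This supplies the cofinality of these inverse images.\<close>

lemma psi_eq:
  assumes \<phi>: "continuous_map X Y \<phi>" and y: "y \<in> topspace Y"
  shows "psi X Y \<phi> y = {U. openin X U \<and> (\<exists>V. openin Y V \<and> y \<in> V \<and> preimage X \<phi> V \<subseteq> U)}" (is "_ = ?F")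
    and topological_filter_psi: "topological_filter X (psi X Y \<phi> y)"
proof -
  have F: "topological_filter X ?F"
    unfolding topological_filter_def
  proof (intro conjI ballI allI impI)
    show "topspace X \<in> ?F"
      using y by (auto simp: preimage_def intro: exI[of _ "topspace Y"])
    fix U V assume "U \<in> ?F" "V \<in> ?F"
    then obtain U' V' where U: "openin X U" "openin Y U'" "y \<in> U'" "preimage X \<phi> U' \<subseteq> U"
      and V: "openin X V" "openin Y V'" "y \<in> V'" "preimage X \<phi> V' \<subseteq> V"
      by auto
    then have "openin X (U \<inter> V)" "openin Y (U' \<inter> V')" "y \<in> U' \<inter> V'"
      "preimage X \<phi> (U' \<inter> V') \<subseteq> U \<inter> V"
      by (auto simp: preimage_def)
    then show "U \<inter> V \<in> ?F" by auto
  next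
    fix U U' assume "U \<in> ?F" "openin X U' \<and> U \<subseteq> U'"
    then show "U' \<in> ?F" by auto
  qed auto
  show eq: "psi X Y \<phi> y = ?F"
  proof
    have "{preimage X \<phi> V |V. openin Y V \<and> y \<in> V} \<subseteq> ?F"
      using openin_preimage[OF \<phi>] by auto
    then show "psi X Y \<phi> y \<subseteq> ?F"
      using F unfolding psi_def generated_filter_def by blast
    show "?F \<subseteq> psi X Y \<phi> y"
      unfolding psi_def generated_filter_def
    proof (intro subsetI InterI)
      fix U F
      assume "U \<in> ?F" and "F \<in> {F. topological_filter X F \<and> {preimage X \<phi> V |V. openin Y V \<and> y \<in> V} \<subseteq> F}"
      then obtain V where "openin X U" "preimage X \<phi> V \<subseteq> U" "preimage X \<phi> V \<in> F" "topological_filter X F"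
        by blast
      then show "U \<in> F" by (simp add: topological_filter_def)
    qed
  qed
  show "topological_filter X (psi X Y \<phi> y)" using F unfolding eq .
qed

lemma mem_psi:
  assumes "continuous_map X Y \<phi>" "y \<in> topspace Y"
  shows "U \<in> psi X Y \<phi> y \<longleftrightarrow>
    openin X U \<and> (\<exists>V. openin Y V \<and> y \<in> V \<and> preimage X \<phi> V \<subseteq> U)"
  by (simp add: psi_eq[OF assms])

text \<open>If \<open>V\<close> witnesses that \<open>U\<close> belongs to the filter at
  \<open>y\<close>, the same \<open>V\<close> is a witness at each of its points.\<close>

lemma continuous_map_psi:
  assumes \<phi>: "continuous_map X Y \<phi>"
  shows "continuous_map Y (filt X) (psi X Y \<phi>)"
proof (rule continuous_map_filtI)
  fix y assume "y \<in> topspace Y"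
  then show "topological_filter X (psi X Y \<phi> y)" by (rule topological_filter_psi[OF \<phi>])
next
  fix U assume U: "openin X U"
  show "openin Y (preimage Y (psi X Y \<phi>) (filt_basic X U))"
    unfolding openin_subopen[of Y "preimage Y (psi X Y \<phi>) (filt_basic X U)"]
  proof
    fix y assume "y \<in> preimage Y (psi X Y \<phi>) (filt_basic X U)"
    then have y: "y \<in> topspace Y" "U \<in> psi X Y \<phi> y" by (simp_all add: preimage_def filt_basic_def)
    then obtain V where V: "openin Y V" "y \<in> V" "preimage X \<phi> V \<subseteq> U"
      by (auto simp: mem_psi[OF \<phi>])
    have "z \<in> preimage Y (psi X Y \<phi>) (filt_basic X U)" if "z \<in> V" for z
    proof -
      have z: "z \<in> topspace Y" using that openin_subset[OF V(1)] by blast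
      then have "U \<in> psi X Y \<phi> z" using U V that by (auto simp: mem_psi[OF \<phi>])
      then show ?thesis
        using z topological_filter_psi[OF \<phi> z] by (simp add: preimage_def filt_basic_def)
    qed
    then show "\<exists>T. openin Y T \<and> y \<in> T \<and> T \<subseteq> preimage Y (psi X Y \<phi>) (filt_basic X U)"
      using V by auto
  qed
qed

lemma preimage_psi_subset:
  assumes \<phi>: "continuous_map X Y \<phi>" and W: "openin (filt X) W"
  shows "preimage X \<phi> (preimage Y (psi X Y \<phi>) W) \<subseteq> preimage X (nbhd_filter X) W"
proof
  fix x assume "x \<in> preimage X \<phi> (preimage Y (psi X Y \<phi>) W)"
  then have x: "x \<in> topspace X" "\<phi> x \<in> topspace Y" "psi X Y \<phi> (\<phi> x) \<in> W"
    by (simp_all add: preimage_def)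
  obtain U where U: "openin X U" "topological_filter X (psi X Y \<phi> (\<phi> x))"
    "U \<in> psi X Y \<phi> (\<phi> x)" "filt_basic X U \<subseteq> W"
    using W x(3) by (rule openin_filt_basis)
  obtain V where "\<phi> x \<in> V" "preimage X \<phi> V \<subseteq> U"
    using U(3) by (auto simp: mem_psi[OF \<phi> x(2)])
  then have "x \<in> U" using x(1) by (auto simp: preimage_def)
  then have "x \<in> preimage X (nbhd_filter X) (filt_basic X U)"
    by (simp add: preimage_nbhd_filter_basic[OF U(1)])
  then show "x \<in> preimage X (nbhd_filter X) W"
    using U(4) by (auto simp: preimage_def)
qed

section \<open>Comparison of the higher direct images\<close>

locale filtrum_comparison =
  fixes X :: "'x topology" and Y :: "'y topology" and \<phi> :: "'x \<Rightarrow> 'y"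
    and I :: "('x, 'u) cochain"
  assumes \<phi>: "continuous_map X Y \<phi>"
    and I_presheaf: "is_presheaf X (obj I n)"
    and I_diff: "sheaf_hom X (obj I n) (obj I (Suc n)) (diff I n)"
    and complex_i: "presheaf_complex (filt X) (direct_image_complex X (nbhd_filter X) I)"
    and complex_\<phi>: "presheaf_complex Y (direct_image_complex X \<phi> I)"
begin

abbreviation "i_pre W \<equiv> preimage X (nbhd_filter X) W"
abbreviation "\<phi>_pre V \<equiv> preimage X \<phi> V"
abbreviation "\<psi>_pre W \<equiv> preimage Y (psi X Y \<phi>) W"
abbreviation "i_cpx \<equiv> direct_image_complex X (nbhd_filter X) I"
abbreviation "\<phi>_cpx \<equiv> direct_image_complex X \<phi> I"

sublocale i: presheaf_complex "filt X" i_cpx by (rule complex_i)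
sublocale \<phi>: presheaf_complex Y \<phi>_cpx by (rule complex_\<phi>)

abbreviation "res n W \<equiv> restr (obj I n) (i_pre W) (\<phi>_pre (\<psi>_pre W))"

text \<open>The map induced on cohomology by restricting cocycles from \<open>i_pre W\<close> to the
  smaller set \<open>\<phi>_pre (\<psi>_pre W)\<close>. As for restriction maps, the factor on the
  left completes the image of a coset to a full coset. It serves as \<open>r\<close> in
  \<open>stalkwise_iso\<close>.\<close>

definition comparison where
  "comparison n W a =
     coboundaries Y \<phi>_cpx n (\<psi>_pre W) <#>\<^bsub>sections (obj I n) (\<phi>_pre (\<psi>_pre W))\<^esub> (res n W ` a)"

lemma open_i_pre: "openin (filt X) W \<Longrightarrow> openin X (i_pre W)"
  by (rule openin_preimage[OF continuous_map_nbhd_filter])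

lemma open_\<phi>_pre: "openin Y V \<Longrightarrow> openin X (\<phi>_pre V)"
  by (rule openin_preimage[OF \<phi>])

lemma open_\<psi>_pre: "openin (filt X) W \<Longrightarrow> openin Y (\<psi>_pre W)"
  by (rule openin_preimage[OF continuous_map_psi[OF \<phi>]])

lemma open_\<phi>\<psi>_pre: "openin (filt X) W \<Longrightarrow> openin X (\<phi>_pre (\<psi>_pre W))"
  by (intro open_\<phi>_pre open_\<psi>_pre)

lemma diff_res:
  "openin (filt X) W \<Longrightarrow> s \<in> carrier (sections (obj I n) (i_pre W)) \<Longrightarrow>
     diff I n (\<phi>_pre (\<psi>_pre W)) (res n W s) = res (Suc n) W (diff I n (i_pre W) s)"
  using I_diff[of n] open_i_pre[of W] open_\<phi>\<psi>_pre[of W] preimage_psi_subset[OF \<phi>, of W]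
  by (simp add: sheaf_hom_def)

lemma res_in_hom:
  "openin (filt X) W \<Longrightarrow>
     res n W \<in> hom (sections (obj I n) (i_pre W)) (sections (obj I n) (\<phi>_pre (\<psi>_pre W)))"
  by (intro presheaf_hom[OF I_presheaf] open_i_pre open_\<phi>\<psi>_pre preimage_psi_subset[OF \<phi>])

lemma res_closed:
  "openin (filt X) W \<Longrightarrow> s \<in> carrier (sections (obj I n) (i_pre W)) \<Longrightarrow>
     res n W s \<in> carrier (sections (obj I n) (\<phi>_pre (\<psi>_pre W)))"
  using res_in_hom by (rule hom_in_carrier)

lemma res_restr:
  assumes W: "openin (filt X) W" and W': "openin (filt X) W'" "W' \<subseteq> W"
    and s: "s \<in> carrier (sections (obj I n) (i_pre W))"
  shows "res n W' (restr (obj I n) (i_pre W) (i_pre W') s) =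
    restr (obj I n) (\<phi>_pre (\<psi>_pre W)) (\<phi>_pre (\<psi>_pre W')) (res n W s)"
  using presheaf_restr_restr[OF I_presheaf open_i_pre[OF W] open_i_pre[OF W'(1)] open_\<phi>\<psi>_pre[OF W'(1)]
      preimage_psi_subset[OF \<phi> W'(1)] preimage_mono[OF W'(2)] s]
    presheaf_restr_restr[OF I_presheaf open_i_pre[OF W] open_\<phi>\<psi>_pre[OF W] open_\<phi>\<psi>_pre[OF W'(1)]
      preimage_mono[OF preimage_mono[OF W'(2)]] preimage_psi_subset[OF \<phi> W] s]
  by simp

lemma res_cocycles:
  assumes "openin (filt X) W" "c \<in> cocycles i_cpx n W"
  shows "res n W c \<in> cocycles \<phi>_cpx n (\<psi>_pre W)"
proof -
  have c: "c \<in> carrier (sections (obj I n) (i_pre W))"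
    "diff I n (i_pre W) c = \<one>\<^bsub>sections (obj I (Suc n)) (i_pre W)\<^esub>"
    using assms(2) by (simp_all add: cocycles_def kernel_sections_def kernel_def direct_image_complex_obj)
  then show ?thesis
    using diff_res[OF assms(1) c(1)] res_closed[OF assms(1) c(1)]
      presheaf_restr_one[OF I_presheaf open_i_pre open_\<phi>\<psi>_pre preimage_psi_subset[OF \<phi>], OF assms(1) assms(1) assms(1)]
    by (simp add: cocycles_def kernel_sections_def kernel_def direct_image_complex_obj)
qed

text \<open>In positive degree a local preimage on a neighbourhood \<open>W'\<close> of the filter
  at \<open>y\<close> restricts to one on \<open>\<psi>_pre W'\<close>, a neighbourhood of
  \<open>y\<close> by continuity. In degree 0 restriction preserves the unit.\<close>

lemma res_coboundaries:
  assumes W: "openin (filt X) W" and c: "c \<in> coboundaries (filt X) i_cpx n W"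
  shows "res n W c \<in> coboundaries Y \<phi>_cpx n (\<psi>_pre W)"
proof (cases n)
  case 0
  then show ?thesis
    using c presheaf_restr_one[OF I_presheaf open_i_pre open_\<phi>\<psi>_pre preimage_psi_subset[OF \<phi>], OF W W W]
    by (simp add: coboundaries_def direct_image_complex_obj)
next
  case (Suc m)
  have c': "c \<in> image_sections (filt X) (obj i_cpx m) (obj i_cpx (Suc m)) (diff i_cpx m) W"
    using c Suc by (simp add: coboundaries_def)
  then have cc: "c \<in> carrier (sections (obj I n) (i_pre W))"
    using Suc by (simp add: image_sections_def direct_image_complex_obj)
  have "res n W c \<in> image_sections Y (obj \<phi>_cpx m) (obj \<phi>_cpx (Suc m)) (diff \<phi>_cpx m) (\<psi>_pre W)"
    unfolding image_sections_def
  proof (intro CollectI conjI ballI)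
    show "res n W c \<in> carrier (sections (obj \<phi>_cpx (Suc m)) (\<psi>_pre W))"
      using res_closed[OF W cc] Suc by (simp add: direct_image_complex_obj)
    fix y assume "y \<in> \<psi>_pre W"
    then have y: "y \<in> topspace Y" "psi X Y \<phi> y \<in> W" by (simp_all add: preimage_def)
    obtain W' b where W': "openin (filt X) W'" "psi X Y \<phi> y \<in> W'" "W' \<subseteq> W"
      and b: "b \<in> carrier (sections (obj i_cpx m) W')"
        "restr (obj i_cpx (Suc m)) W W' c = diff i_cpx m W' b"
      using c' y(2) by (rule image_sectionsE)
    note b = b[unfolded direct_image_complex_obj]
    have "restr (obj I n) (\<phi>_pre (\<psi>_pre W)) (\<phi>_pre (\<psi>_pre W')) (res n W c) =
        res n W' (restr (obj I n) (i_pre W) (i_pre W') c)"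
      using res_restr[OF W W'(1,3) cc] by simp
    also have "\<dots> = diff I m (\<phi>_pre (\<psi>_pre W')) (res m W' b)"
      using diff_res[OF W'(1) b(1)] b(2) Suc by simp
    finally show "\<exists>V. openin Y V \<and> y \<in> V \<and> V \<subseteq> \<psi>_pre W \<and>
        restr (obj \<phi>_cpx (Suc m)) (\<psi>_pre W) V (res n W c) \<in> diff \<phi>_cpx m V ` carrier (sections (obj \<phi>_cpx m) V)"
      using Suc y W' res_closed[OF W'(1) b(1)] open_\<psi>_pre[OF W'(1)] preimage_mono[OF W'(3)]
      by (intro exI[of _ "\<psi>_pre W'"]) (simp add: direct_image_complex_obj preimage_def)
  qed
  then show ?thesis using Suc by (simp add: coboundaries_def)
qed

lemma comparison_class:
  assumes W: "openin (filt X) W" and c: "c \<in> cocycles i_cpx n W"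
  shows "comparison n W (i.coho_class n W c) = \<phi>.coho_class n (\<psi>_pre W) (res n W c)"
  unfolding comparison_def i.coho_class_def \<phi>.coho_class_def direct_image_complex_obj
  using i.coboundaries_subgroup[OF W, of n] \<phi>.coboundaries_subgroup[OF open_\<psi>_pre[OF W], of n]
    i.cocycles_carrier[OF c] res_coboundaries[OF W]
  by (intro subquotient_map_coset presheaf_is_group[OF I_presheaf] open_i_pre open_\<phi>\<psi>_pre res_in_hom W)
    (auto simp: direct_image_complex_obj)

lemma comparison_in_hom:
  assumes W: "openin (filt X) W"
  shows "comparison n W \<in> hom (sections (i.H n) W) (sections (\<phi>.H n) (\<psi>_pre W))"
proof -
  have "(\<lambda>a. comparison n W a) \<in> hom (sections (i.H n) W) (sections (\<phi>.H n) (\<psi>_pre W))"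
    unfolding comparison_def i.H_sections \<phi>.H_sections unfolding direct_image_complex_obj
    using i.coboundaries_subgroup[OF W, of n] \<phi>.coboundaries_subgroup[OF open_\<psi>_pre[OF W], of n]
      i.cocycles_subgroup[OF W, of n] \<phi>.cocycles_subgroup[OF open_\<psi>_pre[OF W], of n]
      res_cocycles[OF W] res_coboundaries[OF W]
    by (intro subquotient_map_hom presheaf_group[OF I_presheaf] open_i_pre open_\<phi>\<psi>_pre res_in_hom W)
      (auto simp: direct_image_complex_obj)
  then show ?thesis .
qed

lemma comparison_sheaf_hom:
  "sheaf_hom (filt X) (i.H n) (direct_image Y (psi X Y \<phi>) (\<phi>.H n)) (comparison n)"
  unfolding sheaf_hom_def direct_image_def presheaf.simps
proof (intro conjI allI impI ballI; (elim conjE)?)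
  fix W assume "openin (filt X) W"
  then show "comparison n W \<in> hom (sections (i.H n) W) (sections (\<phi>.H n) (\<psi>_pre W))"
    by (rule comparison_in_hom)
next
  fix W W' a
  assume W: "openin (filt X) W" and W': "openin (filt X) W'" "W' \<subseteq> W"
    and "a \<in> carrier (sections (i.H n) W)"
  then obtain c where c: "c \<in> cocycles i_cpx n W" "a = i.coho_class n W c"
    by (auto simp: i.H_carrier)
  have cc: "c \<in> carrier (sections (obj I n) (i_pre W))"
    using i.cocycles_carrier[OF c(1)] by (simp add: direct_image_complex_obj)
  show "comparison n W' (restr (i.H n) W W' a) = restr (\<phi>.H n) (\<psi>_pre W) (\<psi>_pre W') (comparison n W a)"
    unfolding c(2) i.H_restr[OF W W' c(1)] comparison_class[OF W'(1) i.cocycles_restr[OF W W' c(1)]]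
      comparison_class[OF W c(1)]
      \<phi>.H_restr[OF open_\<psi>_pre[OF W] open_\<psi>_pre[OF W'(1)] preimage_mono[OF W'(2)] res_cocycles[OF W c(1)]]
    unfolding direct_image_complex_obj res_restr[OF W W' cc] ..
qed

text \<open>The core of injectivity on stalks, and the converse of \<open>res_coboundaries\<close>
  near the filter at \<open>y\<close>. A primitive over \<open>\<phi>_pre V'\<close> can be carried
  to the filtrum because \<open>T V'\<close> is a neighbourhood of that filter with
  \<open>i_pre (T V')\<close> inside \<open>\<phi>_pre V'\<close>. Intersecting with
  \<open>W\<close> keeps the neighbourhood within the domain of \<open>c\<close>.\<close>

lemma coboundary_locally_on_filtrum:
  assumes W: "openin (filt X) W" and y: "y \<in> topspace Y" "psi X Y \<phi> y \<in> W"
    and c: "c \<in> cocycles i_cpx n W"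
    and V: "openin Y V" "y \<in> V" "V \<subseteq> \<psi>_pre W"
    and cob: "restr (obj I n) (i_pre W) (\<phi>_pre V) c \<in> coboundaries Y \<phi>_cpx n V"
  obtains W' where "openin (filt X) W'" "psi X Y \<phi> y \<in> W'" "W' \<subseteq> W"
    "restr (obj I n) (i_pre W) (i_pre W') c \<in> coboundaries (filt X) i_cpx n W'"
proof -
  have cc: "c \<in> carrier (sections (obj I n) (i_pre W))"
    using i.cocycles_carrier[OF c] by (simp add: direct_image_complex_obj)
  text \<open>The open set of filters containing \<open>\<phi>\<inverse>(V)\<close> is a neighbourhood of \<open>\<psi>(y)\<close>,
    and its inverse image under \<open>i\<close> is \<open>\<phi>\<inverse>(V)\<close>.\<close>
  define T where "T V = W \<inter> filt_basic X (\<phi>_pre V)" for V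
  have T: "openin (filt X) (T V)" "psi X Y \<phi> y \<in> T V" "T V \<subseteq> W" "i_pre (T V) \<subseteq> \<phi>_pre V"
    if "openin Y V" "y \<in> V" for V
  proof -
    show "openin (filt X) (T V)"
      unfolding T_def by (intro openin_Int W openin_filt_basic open_\<phi>_pre that)
    show "psi X Y \<phi> y \<in> T V"
      using that y open_\<phi>_pre[OF that(1)] topological_filter_psi[OF \<phi> y(1)]
      by (auto simp: T_def filt_basic_def mem_psi[OF \<phi> y(1)])
    show "T V \<subseteq> W" by (simp add: T_def)
    have "i_pre (T V) \<subseteq> i_pre (filt_basic X (\<phi>_pre V))" by (rule preimage_mono) (simp add: T_def)
    then show "i_pre (T V) \<subseteq> \<phi>_pre V"
      unfolding preimage_nbhd_filter_basic[OF open_\<phi>_pre[OF that(1)]] .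
  qed
  have sub: "\<phi>_pre V \<subseteq> i_pre W"
    using preimage_mono[OF V(3)] preimage_psi_subset[OF \<phi> W] by (rule subset_trans)
  have restr: "restr (obj I n) (i_pre W) (i_pre (T V')) c =
      restr (obj I n) (\<phi>_pre V') (i_pre (T V')) (restr (obj I n) (i_pre W) (\<phi>_pre V') c)"
    if V': "openin Y V'" "y \<in> V'" "V' \<subseteq> V" for V'
    using presheaf_restr_restr[OF I_presheaf open_i_pre[OF W] open_\<phi>_pre[OF V'(1)]
        open_i_pre[OF T(1)[OF V'(1,2)]] T(4)[OF V'(1,2)] subset_trans[OF preimage_mono[OF V'(3)] sub] cc]
    by simp
  show ?thesis
  proof (cases n)
    case 0
    have "restr (obj I n) (i_pre W) (i_pre (T V)) c = \<one>\<^bsub>sections (obj I n) (i_pre (T V))\<^esub>"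
      using restr[OF V(1,2) subset_refl] cob 0
        presheaf_restr_one[OF I_presheaf open_\<phi>_pre[OF V(1)] open_i_pre[OF T(1)[OF V(1,2)]] T(4)[OF V(1,2)]]
      by (simp add: coboundaries_def direct_image_complex_obj)
    then show ?thesis
      using 0 by (intro that[OF T(1-3)[OF V(1,2)]]) (simp add: coboundaries_def direct_image_complex_obj)
  next
    \<comment> \<open>A coboundary over \<open>V\<close> has a primitive \<open>b\<close> only near
      \<open>y\<close>, say over \<open>V'\<close>. Hence \<open>T\<close> is needed at
      \<open>V'\<close> here, whereas in degree 0 it is used at \<open>V\<close> itself.\<close>
    case (Suc m)
    have "restr (obj I n) (i_pre W) (\<phi>_pre V) c \<in>
        image_sections Y (obj \<phi>_cpx m) (obj \<phi>_cpx (Suc m)) (diff \<phi>_cpx m) V"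
      using cob Suc by (simp add: coboundaries_def)
    then obtain V' b where V': "openin Y V'" "y \<in> V'" "V' \<subseteq> V"
      and b: "b \<in> carrier (sections (obj \<phi>_cpx m) V')"
        "restr (obj \<phi>_cpx (Suc m)) V V' (restr (obj I n) (i_pre W) (\<phi>_pre V) c) = diff \<phi>_cpx m V' b"
      using V(2) by (rule image_sectionsE)
    note b = b[unfolded direct_image_complex_obj]
    note T' = T[OF V'(1,2)]
    let ?b = "restr (obj I m) (\<phi>_pre V') (i_pre (T V')) b"
    have bc: "?b \<in> carrier (sections (obj I m) (i_pre (T V')))"
      by (rule presheaf_restr_closed[OF I_presheaf open_\<phi>_pre[OF V'(1)] open_i_pre[OF T'(1)] T'(4) b(1)])
    have "restr (obj I n) (i_pre W) (\<phi>_pre V') c = diff I m (\<phi>_pre V') b"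
      using b(2) Suc presheaf_restr_restr[OF I_presheaf open_i_pre[OF W] open_\<phi>_pre[OF V(1)]
          open_\<phi>_pre[OF V'(1)] preimage_mono[OF V'(3)] sub cc] by simp
    then have eq: "restr (obj I n) (i_pre W) (i_pre (T V')) c = diff I m (i_pre (T V')) ?b"
      using restr[OF V'] Suc I_diff[of m] open_\<phi>_pre[OF V'(1)] open_i_pre[OF T'(1)] T'(4) b(1)
      by (simp add: sheaf_hom_def)
    have "restr (obj I n) (i_pre W) (i_pre (T V')) c \<in>
        image_sections (filt X) (obj i_cpx m) (obj i_cpx (Suc m)) (diff i_cpx m) (T V')"
      unfolding image_sections_def direct_image_complex_obj
    proof (intro CollectI conjI ballI)
      have rc: "restr (obj I n) (i_pre W) (i_pre (T V')) c \<in> carrier (sections (obj I n) (i_pre (T V')))"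
        by (rule presheaf_restr_closed[OF I_presheaf open_i_pre[OF W] open_i_pre[OF T'(1)]
          preimage_mono[OF T'(3)] cc])
      then show "restr (obj I n) (i_pre W) (i_pre (T V')) c \<in>
          carrier (sections (obj I (Suc m)) (i_pre (T V')))"
        unfolding Suc .
      \<comment> \<open>Over \<open>T V'\<close> the restricted cocycle is an actual boundary, of
        \<open>?b\<close>. So \<open>T V'\<close> is a suitable neighbourhood for all of its filters
        at once.\<close>
      fix F assume "F \<in> T V'"
      then show "\<exists>R. openin (filt X) R \<and> F \<in> R \<and> R \<subseteq> T V' \<and>
          restr (obj I (Suc m)) (i_pre (T V')) (i_pre R) (restr (obj I n) (i_pre W) (i_pre (T V')) c)
            \<in> diff I m (i_pre R) ` carrier (sections (obj I m) (i_pre R))"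
        using T'(1) rc bc eq Suc presheaf_restr_id[OF I_presheaf open_i_pre[OF T'(1)]]
        by (intro exI[of _ "T V'"]) simp
    qed
    then show ?thesis
      using Suc by (intro that[OF T'(1-3)]) (simp add: coboundaries_def)
  qed
qed

lemma comparison_stalkwise_iso:
  "stalkwise_iso Y (filt X) (psi X Y \<phi>) (i.H n) (\<phi>.H n) (comparison n)"
proof
  show "continuous_map Y (filt X) (psi X Y \<phi>)" by (rule continuous_map_psi[OF \<phi>])
  show "is_presheaf (filt X) (i.H n)" by (rule i.cohomology_presheaf_is_presheaf)
  show "is_presheaf Y (\<phi>.H n)" by (rule \<phi>.cohomology_presheaf_is_presheaf)
  show "sheaf_hom (filt X) (i.H n) (direct_image Y (psi X Y \<phi>) (\<phi>.H n)) (comparison n)"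
    by (rule comparison_sheaf_hom)
next
  fix W y s V
  assume W: "openin (filt X) W" and y: "y \<in> topspace Y" "psi X Y \<phi> y \<in> W"
    and s: "s \<in> carrier (sections (i.H n) W)"
    and V: "openin Y V" "y \<in> V" "V \<subseteq> \<psi>_pre W"
    and one: "restr (\<phi>.H n) (\<psi>_pre W) V (comparison n W s) = \<one>\<^bsub>sections (\<phi>.H n) V\<^esub>"
  obtain c where c: "c \<in> cocycles i_cpx n W" "s = i.coho_class n W c"
    using s by (auto simp: i.H_carrier)
  have cc: "c \<in> carrier (sections (obj I n) (i_pre W))"
    using i.cocycles_carrier[OF c(1)] by (simp add: direct_image_complex_obj)
  \<comment> \<open>The hypothesis speaks of a class on \<open>Y\<close>, so the cocycle arrives at
    \<open>\<phi>_pre V\<close> in two restrictions. They are merged below into a single restriction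
    of \<open>c\<close>, the form that \<open>coboundary_locally_on_filtrum\<close> expects.\<close>
  let ?cV = "restr (obj \<phi>_cpx n) (\<psi>_pre W) V (res n W c)"
  have cV: "?cV \<in> cocycles \<phi>_cpx n V"
    by (rule \<phi>.cocycles_restr[OF open_\<psi>_pre[OF W] V(1,3) res_cocycles[OF W c(1)]])
  have "\<phi>.coho_class n V ?cV = \<one>\<^bsub>sections (\<phi>.H n) V\<^esub>"
    using one unfolding c(2) comparison_class[OF W c(1)]
      \<phi>.H_restr[OF open_\<psi>_pre[OF W] V(1,3) res_cocycles[OF W c(1)]] .
  then have "?cV \<in> coboundaries Y \<phi>_cpx n V"
    using \<phi>.coho_class_eq_one_iff[OF V(1) cV] by simp
  also have "?cV = restr (obj I n) (i_pre W) (\<phi>_pre V) c"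
    unfolding direct_image_complex_obj
    by (rule presheaf_restr_restr[OF I_presheaf open_i_pre[OF W] open_\<phi>\<psi>_pre[OF W] open_\<phi>_pre[OF V(1)]
      preimage_mono[OF V(3)] preimage_psi_subset[OF \<phi> W] cc])
  finally obtain W' where W': "openin (filt X) W'" "psi X Y \<phi> y \<in> W'" "W' \<subseteq> W"
    "restr (obj I n) (i_pre W) (i_pre W') c \<in> coboundaries (filt X) i_cpx n W'"
    by (rule coboundary_locally_on_filtrum[OF W y c(1) V])
  have "restr (i.H n) W W' s = \<one>\<^bsub>sections (i.H n) W'\<^esub>"
    unfolding c(2) i.H_restr[OF W W'(1,3) c(1)]
      i.coho_class_eq_one_iff[OF W'(1) i.cocycles_restr[OF W W'(1,3) c(1)]]
    unfolding direct_image_complex_obj by (rule W'(4))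
  then show "\<exists>W'. openin (filt X) W' \<and> psi X Y \<phi> y \<in> W' \<and> W' \<subseteq> W \<and>
      restr (i.H n) W W' s = \<one>\<^bsub>sections (i.H n) W'\<^esub>"
    using W' by (intro exI[of _ W']) simp
next
  fix V y q
  assume V: "openin Y V" "y \<in> V" and q: "q \<in> carrier (sections (\<phi>.H n) V)"
  obtain c where c: "c \<in> cocycles \<phi>_cpx n V" "q = \<phi>.coho_class n V c"
    using q by (auto simp: \<phi>.H_carrier)
  have y: "y \<in> topspace Y" using V openin_subset by blast
  \<comment> \<open>The inverse image of this basic set under the canonical map is exactly
    \<open>\<phi>_pre V\<close>, so \<open>c\<close> itself is a cocycle over \<open>?W\<close>.
    Restricting its class back to \<open>V\<close> recovers \<open>q\<close>, and \<open>V\<close>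
    needs no shrinking.\<close>
  let ?W = "filt_basic X (\<phi>_pre V)"
  have W: "openin (filt X) ?W" by (rule openin_filt_basic[OF open_\<phi>_pre[OF V(1)]])
  have pre: "i_pre ?W = \<phi>_pre V" by (rule preimage_nbhd_filter_basic[OF open_\<phi>_pre[OF V(1)]])
  have VW: "V \<subseteq> \<psi>_pre ?W"
  proof
    fix z assume z: "z \<in> V"
    then have "z \<in> topspace Y" using openin_subset[OF V(1)] by blast
    then show "z \<in> \<psi>_pre ?W"
      using z V(1) open_\<phi>_pre[OF V(1)] topological_filter_psi[OF \<phi>]
      by (auto simp: preimage_def[of Y] filt_basic_def mem_psi[OF \<phi>])
  qed
  have cW: "c \<in> cocycles i_cpx n ?W"
    using c(1) unfolding direct_image_complex_cocycles pre .
  have cc: "c \<in> carrier (sections (obj I n) (i_pre ?W))"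
    using i.cocycles_carrier[OF cW] by (simp add: direct_image_complex_obj)
  have "restr (\<phi>.H n) (\<psi>_pre ?W) V (comparison n ?W (i.coho_class n ?W c)) = restr (\<phi>.H n) V V q"
    unfolding c(2) comparison_class[OF W cW] \<phi>.H_restr[OF open_\<psi>_pre[OF W] V(1) VW res_cocycles[OF W cW]]
      \<phi>.H_restr[OF V(1) V(1) subset_refl c(1)]
    unfolding direct_image_complex_obj
      presheaf_restr_restr[OF I_presheaf open_i_pre[OF W] open_\<phi>\<psi>_pre[OF W] open_\<phi>_pre[OF V(1)]
        preimage_mono[OF VW] preimage_psi_subset[OF \<phi> W] cc]
    unfolding pre ..
  moreover have "i.coho_class n ?W c \<in> carrier (sections (i.H n) ?W)"
    using cW by (auto simp: i.H_carrier)
  moreover have "psi X Y \<phi> y \<in> ?W" using V(2) VW by (auto simp: preimage_def)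
  ultimately show "\<exists>W s V'. openin (filt X) W \<and> psi X Y \<phi> y \<in> W \<and> s \<in> carrier (sections (i.H n) W) \<and>
      openin Y V' \<and> y \<in> V' \<and> V' \<subseteq> V \<and> V' \<subseteq> \<psi>_pre W \<and>
      restr (\<phi>.H n) V V' q = restr (\<phi>.H n) (\<psi>_pre W) V' (comparison n W s)"
    using W V VW by (intro exI[of _ ?W] exI[of _ "i.coho_class n ?W c"] exI[of _ V]) simp
qed

text \<open>Canonicity is the formula of \<open>inverse_image_iso\<close> applied to the class of a
  cocycle; \<open>comparison_class\<close> rewrites its right-hand side as the class of the
  restricted cocycle.\<close>

theorem higher_direct_image_comparison:
  "\<exists>\<theta>. sheaf_iso Y (inverse_image Y (filt X) (psi X Y \<phi>)
          (higher_direct_image X (filt X) (nbhd_filter X) I n))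
        (higher_direct_image X Y \<phi> I n) \<theta> \<and>
      canonical_comparison X Y \<phi> I n \<theta>"
proof -
  interpret stalkwise_iso Y "filt X" "psi X Y \<phi>" "i.H n" "\<phi>.H n" "comparison n"
    by (rule comparison_stalkwise_iso)
  obtain \<theta> where iso: "sheaf_iso Y (inverse_image Y (filt X) (psi X Y \<phi>) (sheafify (filt X) (i.H n)))
      (sheafify Y (\<phi>.H n)) \<theta>"
    and \<theta>: "\<forall>W s. openin (filt X) W \<longrightarrow> s \<in> carrier (sections (i.H n) W) \<longrightarrow>
        \<theta> (\<psi>_pre W) (inverse_image_unit Y (filt X) (psi X Y \<phi>) (sheafify (filt X) (i.H n)) W
          (germs (filt X) (i.H n) W s)) = germs Y (\<phi>.H n) (\<psi>_pre W) (comparison n W s)"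
    using inverse_image_iso by (elim exE conjE)
  have "canonical_comparison X Y \<phi> I n \<theta>"
    unfolding canonical_comparison_def
  proof (intro allI impI ballI)
    fix W c assume W: "openin (filt X) W" and c: "c \<in> cocycles i_cpx n W"
    have "i.coho_class n W c \<in> carrier (sections (i.H n) W)"
      using c by (auto simp: i.H_carrier)
    then show "\<theta> (\<psi>_pre W) (inverse_image_unit Y (filt X) (psi X Y \<phi>)
        (higher_direct_image X (filt X) (nbhd_filter X) I n) W (cohomology_class (filt X) i_cpx n W c)) =
      cohomology_class Y \<phi>_cpx n (\<psi>_pre W) (res n W c)"
      using \<theta> W comparison_class[OF W c]
      by (simp add: higher_direct_image_def cohomology_sheaf_def cohomology_class_def
          i.coho_class_def \<phi>.coho_class_def)
  qed
  with iso show ?thesis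
    unfolding higher_direct_image_def cohomology_sheaf_def by (intro exI conjI)
qed

theorem zero_higher_direct_image:
  assumes "zero_sheaf (filt X) (higher_direct_image X (filt X) (nbhd_filter X) I n)"
  shows "zero_sheaf Y (higher_direct_image X Y \<phi> I n)"
  using stalkwise_iso.zero_sheafify[OF comparison_stalkwise_iso] assms
  unfolding higher_direct_image_def cohomology_sheaf_def .

end

theorem mainTheorem7:
  fixes X :: "'x topology" and Y :: "'y topology" and \<phi> :: "'x \<Rightarrow> 'y"
    and G :: "('x, 'u) presheaf" and \<epsilon> :: "'x set \<Rightarrow> 'u \<Rightarrow> 'u" and I :: "('x, 'u) cochain"
    and n :: nat
  assumes "continuous_map X Y \<phi>"
    and "sheaf X G"
    and "injective_resolution X G \<epsilon> I"
  shows "(\<exists>\<theta>. sheaf_iso Y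
                (inverse_image Y (filt X) (psi X Y \<phi>)
                   (higher_direct_image X (filt X) (nbhd_filter X) I n))
                (higher_direct_image X Y \<phi> I n) \<theta> \<and>
              canonical_comparison X Y \<phi> I n \<theta>) \<and>
         (zero_sheaf (filt X) (higher_direct_image X (filt X) (nbhd_filter X) I n) \<longrightarrow>
          zero_sheaf Y (higher_direct_image X Y \<phi> I n))"
proof -
  \<comment> \<open>Both complexes are direct images of the same resolution, along the canonical map
    to the filtrum and along \<open>\<phi>\<close>, so one lemma provides both complex
    conditions.\<close>
  interpret filtrum_comparison X Y \<phi> I
  proof (rule filtrum_comparison.intro)
    show "is_presheaf X (obj I n)" "sheaf_hom X (obj I n) (obj I (Suc n)) (diff I n)" for n
      using assms(3) by (simp_all add: injective_resolution_def injective_sheaf_def sheaf_def)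
    show "continuous_map X Y \<phi>" by (rule assms(1))
    show "presheaf_complex (filt X) (direct_image_complex X (nbhd_filter X) I)"
      by (rule resolution_direct_image_complex[OF continuous_map_nbhd_filter assms(3)])
    show "presheaf_complex Y (direct_image_complex X \<phi> I)"
      by (rule resolution_direct_image_complex[OF assms(1,3)])
  qed
  show ?thesis
    by (intro conjI impI higher_direct_image_comparison zero_higher_direct_image)
qed

end
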